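(* Let $d,n\in\mathbb N$ and $C_1,\ldots,C_n\in M_d(\mathbb C)$. Then $$\int_0^1\operatorname{tr}\left|\sum_{k=1}^n C_k\varepsilon_k(t)\right|dt\le\|(C_k)\|_{S_1^d(\ell_2)}\le\sqrt2\int_0^1\operatorname{tr}\left|\sum_{k=1}^n C_k\varepsilon_k(t)\right|dt .$$ The factor $\sqrt2$ is optimal: the least constant $A_1$ for which $\|(C_k)\|_{S_1^d(\ell_2)}\le A_1\int_0^1\operatorname{tr}\left|\sum_{k=1}^n C_k\varepsilon_k(t)\right|dt$ holds for all $d,n\in\mathbb N$ and all $C_1,\ldots,C_n\in M_d(\mathbb C)$ is $A_1=\sqrt2$.
   Context: $\varepsilon_k(t)=\operatorname{sgn}(\sin(2^k\pi t))$, $k\ge1$, are the Rademacher functions on $[0,1]$ (independent, uniformly distributed on $\{-1,1\}$). $\operatorname{tr}$ is the usual unnormalized trace on $M_d(\mathbb C)$, and $|X|=(X^*X)^{1/2}$. For a finite family $(C_k)$ in $M_d(\mathbb C)$, $$\|(C_k)\|_{S_1^d(\ell_2)}=\inf\left\{\operatorname{tr}\Big(\sum_kX_k^*X_k\Big)^{1/2}+\operatorname{tr}\Big(\sum_kY_kY_k^*\Big)^{1/2}: C_k=X_k+Y_k,\ X_k,Y_k\in M_d(\mathbb C)\right\}.$$ *)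

theory Defs
  imports "HOL-Analysis.Analysis" "Jordan_Normal_Form.Schur_Decomposition"
begin

text \<open>
  The dimension \<open>d\<close> is quantified inside the statement, so \<open>M_d(C)\<close> is \<open>carrier_mat d d\<close>.
\<close>

definition rademacher :: "nat \<Rightarrow> real \<Rightarrow> real" where
  "rademacher k t = sgn (sin (2 ^ k * pi * t))"

definition mat_trace :: "complex mat \<Rightarrow> complex" where
  "mat_trace A = (\<Sum>i<dim_row A. A $$ (i, i))"

text \<open>
  The type of matrices of all sizes is not a commutative monoid, so \<open>sum\<close> does not apply
  to it; the two lemmas below confirm that this is the iterated matrix sum.
\<close>

definition msum :: "nat \<Rightarrow> ('i \<Rightarrow> complex mat) \<Rightarrow> 'i set \<Rightarrow> complex mat" where
  "msum d F K = Matrix.mat d d (\<lambda>ij. \<Sum>k\<in>K. F k $$ ij)"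

lemma msum_empty: "msum d F {} = 0\<^sub>m d d"
  by (rule eq_matI) (auto simp: msum_def)

lemma msum_insert:
  assumes "finite K" "k \<notin> K" "\<And>j. j \<in> insert k K \<Longrightarrow> F j \<in> carrier_mat d d"
  shows "msum d F (insert k K) = F k + msum d F K"
  using assms by (intro eq_matI) (auto simp: msum_def)

definition pos_semidef :: "nat \<Rightarrow> complex mat \<Rightarrow> bool" where
  "pos_semidef d A \<longleftrightarrow> A \<in> carrier_mat d d \<and> mat_adjoint A = A \<and>
     (\<forall>v\<in>carrier_vec d. 0 \<le> Re ((A *\<^sub>v v) \<bullet>c v))"

text \<open>Only meaningful for positive semidefinite \<open>A\<close>, where the root exists and is unique.\<close>

definition psd_sqrt :: "nat \<Rightarrow> complex mat \<Rightarrow> complex mat" where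
  "psd_sqrt d A = (THE B. pos_semidef d B \<and> B * B = A)"

definition mat_abs :: "nat \<Rightarrow> complex mat \<Rightarrow> complex mat" where
  "mat_abs d X = psd_sqrt d (mat_adjoint X * X)"

text \<open>
  In the next two definitions \<open>Re\<close> only converts the type: the traces are those of positive
  semidefinite matrices, hence real. The integrand of the first one is a step function.
\<close>

definition rademacher_avg :: "nat \<Rightarrow> nat \<Rightarrow> (nat \<Rightarrow> complex mat) \<Rightarrow> real" where
  "rademacher_avg d n C = integral {0..1} (\<lambda>t.
     Re (mat_trace (mat_abs d (msum d (\<lambda>k. complex_of_real (rademacher k t) \<cdot>\<^sub>m C k) {1..n}))))"

definition S1_l2_norm :: "nat \<Rightarrow> nat \<Rightarrow> (nat \<Rightarrow> complex mat) \<Rightarrow> real" where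
  "S1_l2_norm d n C = Inf
     {Re (mat_trace (psd_sqrt d (msum d (\<lambda>k. mat_adjoint (X k) * X k) {1..n}))) +
      Re (mat_trace (psd_sqrt d (msum d (\<lambda>k. Y k * mat_adjoint (Y k)) {1..n}))) | X Y.
      \<forall>k\<in>{1..n}. X k \<in> carrier_mat d d \<and> Y k \<in> carrier_mat d d \<and> C k = X k + Y k}"

definition upper_khintchine_const :: "real \<Rightarrow> bool" where
  "upper_khintchine_const A \<longleftrightarrow>
     (\<forall>d n C. (\<forall>k\<in>{1..n}. C k \<in> carrier_mat d d) \<longrightarrow>
        S1_l2_norm d n C \<le> A * rademacher_avg d n C)"

end

theory Submission
  imports Defs
begin

text \<open>
  Write \<open>S = \<Sum>k. \<epsilon>\<^sub>k C\<^sub>k\<close> and \<open>a = E|S|\<close>, \<open>b = E|S*|\<close>. Walsh analysis of the even functions \<open>|S|\<close> and \<open>|S*|\<close> as in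
  Latala--Oleszkiewicz, together with \<open>2 Re tr A*B \<le> tr |A||B| + tr |A*||B*|\<close>, gives
  \<open>E \<parallel>S\<parallel>\<^sub>2\<^sup>2 \<le> \<parallel>a\<parallel>\<^sub>2\<^sup>2 + \<parallel>b\<parallel>\<^sub>2\<^sup>2 =: q\<close>.
  For the passage from exponent 2 to exponent 1, fix \<open>D\<close> with \<open>\<Sum> D\<^sub>k*D\<^sub>k \<le> 1\<close> and \<open>\<Sum> D\<^sub>kD\<^sub>k* \<le> 1\<close>, and let \<open>C\<close>
  maximize \<open>\<langle>D, C\<rangle> / E tr|S|\<close>, with maximum \<open>A\<close>. Stationarity along \<open>C \<mapsto> (1 + tb) C (1 + ta)\<close> yields
  \<open>A q = \<langle>D, bC + Ca\<rangle> = \<langle>bD + Da, C\<rangle> \<le> \<surd>(2q) (\<Sum> \<parallel>C\<^sub>k\<parallel>\<^sub>2\<^sup>2)\<^bsup>1/2\<^esup> \<le> \<surd>2 q\<close>, hence \<open>A \<le> \<surd>2\<close>. Duality, made explicit by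
  the Euler equation of a regularized minimization problem, turns this into the upper estimate.
  The lower estimate is Jensen's inequality for the trace of the square root.
\<close>

subsection \<open>Finitely supported complex matrices\<close>

text \<open>Since d is quantified inside the statement, no type consists of the d x d matrices. All
  sizes are embedded in one type of finitely supported infinite matrices, a ring and a real inner
  product space, so that \<open>sum\<close>, norms and continuity apply. \<open>idm d\<close> stands
  in for the missing unit, and matrices W serve as test objects instead of vectors. The obstacle
  lies in the passage to exponent 1. Bounding the Hilbert-Schmidt norms of a and b by their traces
  would end the scalar proof, but here it only gives sqrt 2 times the average as a bound for the
  square root of the sum of squared Hilbert-Schmidt norms of the C_k, a quantity below the norm in
  question. The extremal C avoids this loss: stationarity produces an inequality with q on both
  sides, and q cancels. No derivative is taken anywhere: each first-order condition comes from an
  upper bound that is quadratic in t and valid for all real t. The shift by e^2 makes the matrices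
  under the square roots invertible, so that the concave trace of the square root has a tangent; the
  cost 2 e d vanishes with e.\<close>

typedef cmat = "{A :: nat \<Rightarrow> nat \<Rightarrow> complex. \<exists>d. \<forall>i j. d \<le> i \<or> d \<le> j \<longrightarrow> A i j = 0}"
  morphisms entry Cmat
  by (rule exI[of _ "\<lambda>_ _. 0"]) auto

definition mats :: "nat \<Rightarrow> cmat set" where
  "mats d = {A. \<forall>i j. d \<le> i \<or> d \<le> j \<longrightarrow> entry A i j = 0}"

lemma ex_mats: "\<exists>d. A \<in> mats d"
  using entry[of A] by (auto simp: mats_def)

lemma mats_mono: "A \<in> mats d \<Longrightarrow> d \<le> e \<Longrightarrow> A \<in> mats e"
  by (auto simp: mats_def)

lemma ex_mats3: "\<exists>d. A \<in> mats d \<and> B \<in> mats d \<and> C \<in> mats d"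
proof -
  obtain d e f where "A \<in> mats d" "B \<in> mats e" "C \<in> mats f" using ex_mats by meson
  then have "A \<in> mats (d + e + f) \<and> B \<in> mats (d + e + f) \<and> C \<in> mats (d + e + f)"
    by (auto elim: mats_mono)
  then show ?thesis by blast
qed

lemma ex_mats2: "\<exists>d. A \<in> mats d \<and> B \<in> mats d"
  using ex_mats3[of A B B] by blast

lemma mats_entry: "A \<in> mats d \<Longrightarrow> d \<le> i \<or> d \<le> j \<Longrightarrow> entry A i j = 0"
  by (auto simp: mats_def)

lemma mats_nonzeroD: "A \<in> mats d \<Longrightarrow> entry A i j \<noteq> 0 \<Longrightarrow> i < d \<and> j < d"
  by (meson mats_entry not_less)

lemma cmat_eqI: "(\<And>i j. entry A i j = entry B i j) \<Longrightarrow> A = B"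
  by (metis entry_inject ext)

lemma entry_Cmat:
  assumes "\<And>i j. d \<le> i \<or> d \<le> j \<Longrightarrow> F i j = 0"
  shows "entry (Cmat F) = F" "Cmat F \<in> mats d"
proof -
  show "entry (Cmat F) = F" using assms by (intro Cmat_inverse) blast
  then show "Cmat F \<in> mats d" using assms by (auto simp: mats_def)
qed

instantiation cmat :: ring
begin

definition "0 = Cmat (\<lambda>_ _. 0)"
definition "A + B = Cmat (\<lambda>i j. entry A i j + entry B i j)"
definition "- A = Cmat (\<lambda>i j. - entry A i j)"
definition "A - B = (A :: cmat) + - B"
text \<open>Summing over the support of row i of A gives a finite sum without naming a size.\<close>

definition "A * B = Cmat (\<lambda>i j. \<Sum>k | entry A i k \<noteq> 0. entry A i k * entry B k j)"

lemma entry_zero [simp]: "entry 0 i j = 0"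
  unfolding zero_cmat_def by (subst entry_Cmat(1)[of 0]) auto

lemma entry_add [simp]: "entry (A + B) i j = entry A i j + entry B i j"
proof -
  obtain d where "A \<in> mats d" "B \<in> mats d" using ex_mats2 by blast
  then show ?thesis unfolding plus_cmat_def by (subst entry_Cmat(1)[of d]) (auto simp: mats_def)
qed

lemma entry_uminus [simp]: "entry (- A) i j = - entry A i j"
proof -
  obtain d where "A \<in> mats d" using ex_mats by blast
  then show ?thesis unfolding uminus_cmat_def by (subst entry_Cmat(1)[of d]) (auto simp: mats_def)
qed

lemma entry_diff [simp]: "entry (A - B) i j = entry A i j - entry B i j"
  by (simp add: minus_cmat_def)

lemma entry_mult_raw: "entry (A * B) i j = (\<Sum>k | entry A i k \<noteq> 0. entry A i k * entry B k j)"
proof -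
  obtain d where d: "A \<in> mats d" "B \<in> mats d" using ex_mats2 by blast
  have "(\<Sum>k | entry A i k \<noteq> 0. entry A i k * entry B k j) = 0" if "d \<le> i \<or> d \<le> j" for i j
  proof (rule sum.neutral, rule ballI)
    fix k
    have "entry A i k = 0 \<or> entry B k j = 0"
      using that mats_entry[OF d(1), of i k] mats_entry[OF d(2), of k j] by blast
    then show "entry A i k * entry B k j = 0" by simp
  qed
  from entry_Cmat(1)[of d "\<lambda>i j. \<Sum>k | entry A i k \<noteq> 0. entry A i k * entry B k j", OF this]
  show ?thesis unfolding times_cmat_def by (rule fun_cong[OF fun_cong])
qed

text \<open>A size bound on one factor suffices, since beyond d every summand contains a zero
  entry.\<close>

lemma entry_mult:
  assumes "A \<in> mats d \<or> B \<in> mats d"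
  shows "entry (A * B) i j = (\<Sum>k<d. entry A i k * entry B k j)"
proof -
  obtain e where e: "A \<in> mats e" using ex_mats by blast
  have fin: "finite {k. entry A i k \<noteq> 0}"
    by (rule finite_subset[of _ "{..<e}"]) (use e in \<open>auto dest: mats_nonzeroD\<close>)
  have "(\<Sum>k | entry A i k \<noteq> 0. entry A i k * entry B k j) =
        (\<Sum>k\<in>{k. entry A i k \<noteq> 0} \<union> {..<d}. entry A i k * entry B k j)"
    using fin by (intro sum.mono_neutral_left) auto
  also have "\<dots> = (\<Sum>k<d. entry A i k * entry B k j)"
    using fin assms by (intro sum.mono_neutral_right) (auto simp: mats_def not_less)
  finally show ?thesis by (simp add: entry_mult_raw)
qed

instance
proof
  fix A B C :: cmat
  show "A + B + C = A + (B + C)" by (rule cmat_eqI) simp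
  show "A + B = B + A" by (rule cmat_eqI) simp
  show "0 + A = A" by (rule cmat_eqI) simp
  show "- A + A = 0" by (rule cmat_eqI) simp
  show "A - B = A + - B" by (rule cmat_eqI) simp
  obtain d where d: "A \<in> mats d" "B \<in> mats d" "C \<in> mats d" using ex_mats3 by blast
  show "A * B * C = A * (B * C)"
  proof (rule cmat_eqI)
    fix i j
    have "entry (A * B * C) i j = (\<Sum>k<d. \<Sum>l<d. entry A i l * entry B l k * entry C k j)"
      using d by (simp add: entry_mult[of _ d] sum_distrib_right)
    also have "\<dots> = (\<Sum>l<d. \<Sum>k<d. entry A i l * entry B l k * entry C k j)"
      by (rule sum.swap)
    also have "\<dots> = entry (A * (B * C)) i j"
      using d by (simp add: entry_mult[of _ d] sum_distrib_left mult.assoc)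
    finally show "entry (A * B * C) i j = entry (A * (B * C)) i j" .
  qed
  show "(A + B) * C = A * C + B * C"
    by (rule cmat_eqI) (use d in \<open>simp add: entry_mult[of _ d] distrib_right sum.distrib\<close>)
  show "A * (B + C) = A * B + A * C"
    by (rule cmat_eqI) (use d in \<open>simp add: entry_mult[of _ d] distrib_left sum.distrib\<close>)
qed

end

lemma entry_sum [simp]: "entry (\<Sum>k\<in>K. F k) i j = (\<Sum>k\<in>K. entry (F k) i j)"
  by (induction K rule: infinite_finite_induct) auto

definition adj :: "cmat \<Rightarrow> cmat" where
  "adj A = Cmat (\<lambda>i j. cnj (entry A j i))"

lemma entry_adj [simp]: "entry (adj A) i j = cnj (entry A j i)"
proof -
  obtain d where "A \<in> mats d" using ex_mats by blast
  then show ?thesis unfolding adj_def by (subst entry_Cmat(1)[of d]) (auto simp: mats_def)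
qed

text \<open>The real part of the trace. It makes \<open>inner\<close> below the real part of the
  Hilbert-Schmidt product and \<open>norm\<close> the Frobenius norm.\<close>

definition rtr :: "cmat \<Rightarrow> real" where
  "rtr A = (\<Sum>i | entry A i i \<noteq> 0. Re (entry A i i))"

lemma rtr_eq:
  assumes "A \<in> mats d"
  shows "rtr A = (\<Sum>i<d. Re (entry A i i))"
  unfolding rtr_def using assms
  by (intro sum.mono_neutral_left) (auto dest: mats_nonzeroD)

definition idm :: "nat \<Rightarrow> cmat" where
  "idm d = Cmat (\<lambda>i j. if i = j \<and> i < d then 1 else 0)"

lemma entry_idm [simp]: "entry (idm d) i j = (if i = j \<and> i < d then 1 else 0)"
  unfolding idm_def by (subst entry_Cmat(1)[of d]) auto

definition cscale :: "complex \<Rightarrow> cmat \<Rightarrow> cmat" where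
  "cscale c A = Cmat (\<lambda>i j. c * entry A i j)"

lemma entry_cscale [simp]: "entry (cscale c A) i j = c * entry A i j"
proof -
  obtain d where "A \<in> mats d" using ex_mats by blast
  then show ?thesis unfolding cscale_def by (subst entry_Cmat(1)[of d]) (auto simp: mats_def)
qed

instantiation cmat :: real_inner
begin

definition "scaleR r A = cscale (complex_of_real r) A"
definition "inner A B = rtr (adj A * B)"
definition "norm A = sqrt (inner A (A::cmat))"
definition "dist A B = norm (A - (B::cmat))"
definition "sgn A = inverse (norm A) *\<^sub>R (A::cmat)"
definition "uniformity = (INF e\<in>{0<..}. principal {(A, B::cmat). dist A B < e})"
definition "open (U::cmat set) \<longleftrightarrow> (\<forall>x\<in>U. \<forall>\<^sub>F (x', y) in uniformity. x' = x \<longrightarrow> y \<in> U)"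

lemma entry_scaleR [simp]: "entry (r *\<^sub>R A) i j = complex_of_real r * entry A i j"
  by (simp add: scaleR_cmat_def)

lemma inner_cmat:
  assumes "A \<in> mats d \<or> B \<in> mats d"
  shows "inner A B = (\<Sum>i<d. \<Sum>j<d. Re (cnj (entry A i j) * entry B i j))"
proof -
  obtain e' where e': "A \<in> mats e'" "B \<in> mats e'" using ex_mats2 by blast
  define e where "e = max d e'"
  have e: "A \<in> mats e" "B \<in> mats e" using e' by (auto simp: e_def intro: mats_mono)
  have "adj A * B \<in> mats e"
    using e by (auto simp: mats_def entry_mult[of _ e])
  then have "inner A B = (\<Sum>j<e. \<Sum>i<e. Re (cnj (entry A i j) * entry B i j))"
    unfolding inner_cmat_def using e by (simp add: rtr_eq entry_mult[of _ e])
  also have "\<dots> = (\<Sum>i<e. \<Sum>j<e. Re (cnj (entry A i j) * entry B i j))"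
    by (rule sum.swap)
  also have "\<dots> = (\<Sum>i<d. \<Sum>j<e. Re (cnj (entry A i j) * entry B i j))"
    using assms by (intro sum.mono_neutral_right) (auto simp: mats_def e_def)
  also have "\<dots> = (\<Sum>i<d. \<Sum>j<d. Re (cnj (entry A i j) * entry B i j))"
    using assms by (intro sum.cong sum.mono_neutral_right refl) (auto simp: mats_def e_def)
  finally show ?thesis .
qed

lemma inner_self_cmat:
  assumes "A \<in> mats d"
  shows "inner A A = (\<Sum>i<d. \<Sum>j<d. (cmod (entry A i j))\<^sup>2)"
proof -
  have "Re (cnj z * z) = (cmod z)\<^sup>2" for z
    by (simp add: cmod_power2 power2_eq_square[symmetric])
  then show ?thesis using assms by (simp add: inner_cmat[of _ d])
qed

instance
proof
  fix A B C :: cmat and r s :: real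
  show "dist A B = norm (A - B)" by (fact dist_cmat_def)
  show "sgn A = inverse (norm A) *\<^sub>R A" by (fact sgn_cmat_def)
  show "uniformity = (INF e\<in>{0<..}. principal {(A, B::cmat). dist A B < e})"
    by (fact uniformity_cmat_def)
  show "open U = (\<forall>x\<in>U. \<forall>\<^sub>F (x', y) in uniformity. x' = x \<longrightarrow> y \<in> U)" for U :: "cmat set"
    by (fact open_cmat_def)
  show "norm A = sqrt (inner A A)" by (fact norm_cmat_def)
  show "r *\<^sub>R (A + B) = r *\<^sub>R A + r *\<^sub>R B" by (rule cmat_eqI) (simp add: algebra_simps)
  show "(r + s) *\<^sub>R A = r *\<^sub>R A + s *\<^sub>R A" by (rule cmat_eqI) (simp add: algebra_simps)
  show "r *\<^sub>R s *\<^sub>R A = (r * s) *\<^sub>R A" by (rule cmat_eqI) simp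
  show "1 *\<^sub>R A = A" by (rule cmat_eqI) simp
  obtain d where d: "A \<in> mats d" "B \<in> mats d" "C \<in> mats d" using ex_mats3 by blast
  show "inner A B = inner B A"
    using d by (simp add: inner_cmat[of _ d] mult.commute)
  have AB: "A + B \<in> mats d" "r *\<^sub>R A \<in> mats d" using d by (auto simp: mats_def)
  show "inner (A + B) C = inner A C + inner B C"
    using d AB by (simp add: inner_cmat[of _ d] ring_distribs sum.distrib)
  show "inner (r *\<^sub>R A) B = r * inner A B"
    using d AB by (simp add: inner_cmat[of _ d] sum_distrib_left distrib_left mult.assoc)
  show "0 \<le> inner A A"
    using d by (auto simp: inner_self_cmat[of _ d] intro!: sum_nonneg)
  show "(inner A A = 0) = (A = 0)"
  proof
    assume 0: "inner A A = 0"
    show "A = 0"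
    proof (rule cmat_eqI)
      fix i j
      have "(\<Sum>i<d. \<Sum>j<d. (cmod (entry A i j))\<^sup>2) = 0"
        using d 0 by (simp add: inner_self_cmat[of _ d])
      then have "\<forall>i<d. \<forall>j<d. entry A i j = 0"
        by (subst (asm) sum_nonneg_eq_0_iff) (auto simp: sum_nonneg sum_nonneg_eq_0_iff)
      then show "entry A i j = entry 0 i j"
        using mats_entry[OF d(1), of i j] by (cases "i < d \<and> j < d") auto
    qed
  qed (simp add: inner_cmat[of _ 0] mats_def)
qed

end

lemma norm_cmat_L2:
  assumes "A \<in> mats d"
  shows "norm A = L2_set (\<lambda>i. L2_set (\<lambda>j. cmod (entry A i j)) {..<d}) {..<d}"
  by (simp add: norm_cmat_def inner_self_cmat[OF assms] L2_set_def sum_nonneg)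

lemma zero_mats [simp]: "0 \<in> mats d" by (simp add: mats_def)
lemma add_mats [simp]: "A \<in> mats d \<Longrightarrow> B \<in> mats d \<Longrightarrow> A + B \<in> mats d" by (simp add: mats_def)
lemma diff_mats [simp]: "A \<in> mats d \<Longrightarrow> B \<in> mats d \<Longrightarrow> A - B \<in> mats d" by (simp add: mats_def)
lemma uminus_mats [simp]: "A \<in> mats d \<Longrightarrow> - A \<in> mats d" by (simp add: mats_def)
lemma scaleR_mats [simp]: "A \<in> mats d \<Longrightarrow> r *\<^sub>R A \<in> mats d" by (simp add: mats_def)
lemma adj_mats [simp]: "A \<in> mats d \<Longrightarrow> adj A \<in> mats d" by (auto simp: mats_def)
lemma idm_mats [simp]: "idm d \<in> mats d" by (auto simp: mats_def)
lemma mult_mats [simp]: "A \<in> mats d \<Longrightarrow> B \<in> mats d \<Longrightarrow> A * B \<in> mats d"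
  by (auto simp: mats_def entry_mult[of _ d])
lemma sum_mats [simp]: "(\<And>k. k \<in> K \<Longrightarrow> F k \<in> mats d) \<Longrightarrow> sum F K \<in> mats d"
  by (induction K rule: infinite_finite_induct) auto

lemma adj_zero [simp]: "adj 0 = 0" by (rule cmat_eqI) simp
lemma adj_adj [simp]: "adj (adj A) = A" by (rule cmat_eqI) simp
lemma adj_add: "adj (A + B) = adj A + adj B" by (rule cmat_eqI) simp
lemma adj_diff: "adj (A - B) = adj A - adj B" by (rule cmat_eqI) simp
lemma adj_uminus: "adj (- A) = - adj A" by (rule cmat_eqI) simp
lemma adj_scaleR: "adj (r *\<^sub>R A) = r *\<^sub>R adj A" by (rule cmat_eqI) simp
lemma adj_sum: "adj (sum F K) = (\<Sum>k\<in>K. adj (F k))" by (rule cmat_eqI) simp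
lemma adj_idm [simp]: "adj (idm d) = idm d" by (rule cmat_eqI) auto
lemma adj_mult: "adj (A * B) = adj B * adj A"
proof -
  obtain d where "A \<in> mats d" "B \<in> mats d" using ex_mats2 by blast
  then show ?thesis by (intro cmat_eqI) (simp add: entry_mult[of _ d] mult.commute)
qed

lemma idm_mult [simp]: "A \<in> mats d \<Longrightarrow> idm d * A = A"
proof (rule cmat_eqI)
  fix i j assume A: "A \<in> mats d"
  have "(\<Sum>k<d. (if i = k \<and> i < d then 1 else 0) * entry A k j) = (if i < d then entry A i j else 0)"
    by (cases "i < d") (auto simp: if_distrib[of "\<lambda>x. x * _"] cong: if_cong)
  then show "entry (idm d * A) i j = entry A i j"
    using A by (simp add: entry_mult[of _ d] mats_entry)
qed

lemma mult_idm [simp]: "A \<in> mats d \<Longrightarrow> A * idm d = A"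
  by (metis adj_adj adj_idm adj_mats adj_mult idm_mult)

lemma rtr_zero [simp]: "rtr 0 = 0" by (simp add: rtr_def)

lemma rtr_add: "rtr (A + B) = rtr A + rtr B"
proof -
  obtain d where "A \<in> mats d" "B \<in> mats d" using ex_mats2 by blast
  then show ?thesis by (simp add: rtr_eq[of _ d] sum.distrib)
qed

lemma rtr_scaleR: "rtr (r *\<^sub>R A) = r * rtr A"
proof -
  obtain d where "A \<in> mats d" using ex_mats by blast
  then show ?thesis by (simp add: rtr_eq[of _ d] sum_distrib_left)
qed

lemma rtr_uminus: "rtr (- A) = - rtr A"
  using rtr_scaleR[of "-1" A] by simp

lemma rtr_diff: "rtr (A - B) = rtr A - rtr B"
  using rtr_add[of A "- B"] by (simp add: rtr_uminus)

lemma rtr_sum: "rtr (sum F K) = (\<Sum>k\<in>K. rtr (F k))"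
  by (induction K rule: infinite_finite_induct) (auto simp: rtr_add)

lemma rtr_adj [simp]: "rtr (adj A) = rtr A"
  by (simp add: rtr_def)

lemma rtr_commute: "rtr (A * B) = rtr (B * A)"
proof -
  obtain d where d: "A \<in> mats d" "B \<in> mats d" using ex_mats2 by blast
  have "rtr (A * B) = (\<Sum>i<d. \<Sum>k<d. Re (entry A i k * entry B k i))"
    using d by (simp add: rtr_eq[of _ d] entry_mult[of _ d])
  also have "\<dots> = (\<Sum>k<d. \<Sum>i<d. Re (entry A i k * entry B k i))" by (rule sum.swap)
  also have "\<dots> = rtr (B * A)"
    using d by (simp add: rtr_eq[of _ d] entry_mult[of _ d] mult.commute)
  finally show ?thesis .
qed

lemma rtr_idm [simp]: "rtr (idm d) = real d"
  by (simp add: rtr_eq[of _ d])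

lemma inner_mult_left: "inner (A * B) C = inner B (adj A * C)"
  by (simp add: inner_cmat_def adj_mult mult.assoc)

lemma inner_mult_right: "inner (A * B) C = inner A (C * adj B)"
  by (simp add: inner_cmat_def adj_mult rtr_commute[of "adj B"] mult.assoc)

lemma inner_adj: "inner (adj A) (adj B) = inner A B"
  unfolding inner_cmat_def by (metis adj_adj adj_mult rtr_adj rtr_commute)

lemma norm_adj [simp]: "norm (adj A) = norm A"
  by (simp add: norm_eq_sqrt_inner inner_adj)

lemma inner_idm: "A \<in> mats d \<Longrightarrow> inner (idm d) A = rtr A"
  by (simp add: inner_cmat_def)

lemma norm_sq_rtr: "(norm A)\<^sup>2 = rtr (adj A * A)"
  by (simp add: power2_norm_eq_inner inner_cmat_def)

lemma rtr_le_norm: "A \<in> mats d \<Longrightarrow> \<bar>rtr A\<bar> \<le> sqrt d * norm A"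
  using Cauchy_Schwarz_ineq2[of "idm d" A] norm_sq_rtr[of "idm d"]
  by (simp add: inner_idm norm_eq_sqrt_inner inner_cmat_def)

text \<open>Cauchy-Schwarz for row i of A and column j of B, then L2 sums over j and i. This makes
  \<open>cmat\<close> a \<open>real_normed_algebra\<close>, which supplies continuity of
  products.\<close>

lemma norm_mult_cmat: "norm (A * B) \<le> norm A * norm (B :: cmat)"
proof -
  obtain d where d: "A \<in> mats d" "B \<in> mats d" using ex_mats2 by blast
  let ?r = "\<lambda>i. L2_set (\<lambda>j. cmod (entry A i j)) {..<d}"
  let ?c = "\<lambda>j. L2_set (\<lambda>i. cmod (entry (adj B) j i)) {..<d}"
  have 1: "cmod (entry (A * B) i j) \<le> ?r i * ?c j" for i j
  proof -
    have "cmod (entry (A * B) i j) \<le> (\<Sum>k<d. \<bar>cmod (entry A i k)\<bar> * \<bar>cmod (entry (adj B) j k)\<bar>)"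
      using d by (auto simp: entry_mult[of _ d] norm_mult intro!: order_trans[OF norm_sum])
    also have "\<dots> \<le> ?r i * ?c j" by (rule L2_set_mult_ineq)
    finally show ?thesis .
  qed
  have "norm (A * B) = L2_set (\<lambda>i. L2_set (\<lambda>j. cmod (entry (A * B) i j)) {..<d}) {..<d}"
    using d by (simp add: norm_cmat_L2[of _ d])
  also have "\<dots> \<le> L2_set (\<lambda>i. ?r i * norm B) {..<d}"
  proof (rule L2_set_mono)
    fix i assume "i \<in> {..<d}"
    have "L2_set (\<lambda>j. cmod (entry (A * B) i j)) {..<d} \<le> L2_set (\<lambda>j. ?r i * ?c j) {..<d}"
      using 1 by (intro L2_set_mono) auto
    also have "\<dots> = ?r i * L2_set ?c {..<d}" by (simp add: L2_set_right_distrib)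
    also have "L2_set ?c {..<d} = norm B"
      using d norm_cmat_L2[of "adj B" d] by simp
    finally show "L2_set (\<lambda>j. cmod (entry (A * B) i j)) {..<d} \<le> ?r i * norm B" .
  qed simp
  also have "\<dots> = norm A * norm B"
    using d by (simp add: L2_set_left_distrib[symmetric] norm_cmat_L2[of A d])
  finally show ?thesis .
qed

instance cmat :: real_normed_algebra
proof
  fix A B :: cmat and r :: real
  obtain d where d: "A \<in> mats d" "B \<in> mats d" using ex_mats2 by blast
  show "r *\<^sub>R A * B = r *\<^sub>R (A * B)"
    by (rule cmat_eqI) (use d in \<open>simp add: entry_mult[of _ d] sum_distrib_left mult.assoc\<close>)
  show "A * r *\<^sub>R B = r *\<^sub>R (A * B)"
    by (rule cmat_eqI) (use d in \<open>simp add: entry_mult[of _ d] sum_distrib_left mult.left_commute\<close>)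
  show "norm (A * B) \<le> norm A * norm B" by (rule norm_mult_cmat)
qed

lemma norm_entry_le: "cmod (entry A i j) \<le> norm A"
proof -
  obtain d where d: "A \<in> mats d" using ex_mats by blast
  show ?thesis
  proof (cases "i < d \<and> j < d")
    case True
    then have "cmod (entry A i j) \<le> L2_set (\<lambda>j. cmod (entry A i j)) {..<d}"
      by (intro member_le_L2_set) auto
    also have "\<dots> \<le> norm A" using True unfolding norm_cmat_L2[OF d]
      by (intro member_le_L2_set) auto
    finally show ?thesis .
  qed (use d in \<open>auto simp: mats_def not_less\<close>)
qed

subsection \<open>Positive matrices and the spectral theorem\<close>

text \<open>Tychonoff. \<open>cmat\<close> is infinite-dimensional, so its balls are not compact;
  compactness is taken from products, of entries for matrices and of matrices for
  \<open>families\<close>.\<close>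

lemma compact_PiE_UNIV:
  fixes K :: "'i \<Rightarrow> 'a::topological_space set"
  assumes "\<And>k. compact (K k)"
  shows "compact (PiE UNIV K)"
proof -
  have "compactin (product_topology (\<lambda>_. euclidean) UNIV) (PiE UNIV K)"
    using assms by (subst compactin_PiE) (auto simp: compactin_euclidean_iff)
  then show ?thesis by (simp add: euclidean_product_topology compactin_euclidean_iff)
qed

definition cunit :: "nat \<Rightarrow> nat \<Rightarrow> complex \<Rightarrow> cmat" where
  "cunit i j z = Cmat (\<lambda>k l. if k = i \<and> l = j then z else 0)"

lemma entry_cunit [simp]: "entry (cunit i j z) k l = (if k = i \<and> l = j then z else 0)"
  unfolding cunit_def by (subst entry_Cmat(1)[of "Suc (max i j)"]) auto

lemma cunit_mats: "i < d \<Longrightarrow> j < d \<Longrightarrow> cunit i j z \<in> mats d"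
  by (auto simp: mats_def)

lemma norm_cunit: "norm (cunit i j z) = cmod z"
proof -
  let ?d = "Suc (max i j)"
  have *: "(cmod (entry (cunit i j z) k l))\<^sup>2 = (if k = i then if l = j then (cmod z)\<^sup>2 else 0 else 0)"
    for k l by simp
  have "(\<Sum>l<?d. if k = i then if l = j then (cmod z)\<^sup>2 else 0 else 0) = (if k = i then (cmod z)\<^sup>2 else 0)" for k
    by (cases "k = i") auto
  then have "inner (cunit i j z) (cunit i j z) = (cmod z)\<^sup>2"
    by (subst inner_self_cmat[of _ ?d]) (auto simp: cunit_mats * simp del: entry_cunit)
  then show ?thesis by (simp add: norm_eq_sqrt_inner)
qed

lemma bounded_linear_cunit: "bounded_linear (cunit i j)"
  by (rule bounded_linear_intro[where K = 1]) (auto intro!: cmat_eqI simp: norm_cunit scaleR_conv_of_real)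

lemma cmat_expand:
  assumes "A \<in> mats d"
  shows "A = (\<Sum>i<d. \<Sum>j<d. cunit i j (entry A i j))"
proof (rule cmat_eqI)
  fix k l
  have "(\<Sum>i<d. \<Sum>j<d. if k = i \<and> l = j then entry A i j else 0) =
        (\<Sum>i<d. if k = i then if l < d then entry A i l else 0 else 0)"
    by (intro sum.cong) auto
  also have "\<dots> = entry A k l"
    using assms by (auto simp: mats_entry)
  finally show "entry A k l = entry (\<Sum>i<d. \<Sum>j<d. cunit i j (entry A i j)) k l" by simp
qed

text \<open>For fixed d, a product of discs, one per entry, is mapped continuously to matrices; the
  ball is the image cut down to norm at most r.\<close>

lemma compact_mats_cball: "compact {A \<in> mats d. norm A \<le> r}"
proof -
  let ?K = "PiE UNIV (\<lambda>_::nat \<times> nat. cball (0::complex) r)"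
  let ?F = "\<lambda>c. \<Sum>i<d. \<Sum>j<d. cunit i j (c (i, j))"
  have cont: "continuous_on ?K ?F"
  proof (rule continuous_on_sum, rule continuous_on_sum)
    fix i j
    have "continuous_on ?K (\<lambda>c. c (i, j))"
      by (rule continuous_on_subset[OF continuous_on_product_coordinates subset_UNIV])
    then show "continuous_on ?K (\<lambda>c. cunit i j (c (i, j)))"
      by (rule bounded_linear.continuous_on[OF bounded_linear_cunit])
  qed
  have "compact ?K" by (rule compact_PiE_UNIV) (rule compact_cball)
  with cont have "compact (?F ` ?K)" by (rule compact_continuous_image)
  then have "compact (?F ` ?K \<inter> cball 0 r)" using closed_cball by (rule compact_Int_closed)
  also have "?F ` ?K \<inter> cball 0 r = {A \<in> mats d. norm A \<le> r}"
  proof (intro equalityI subsetI)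
    fix A assume "A \<in> ?F ` ?K \<inter> cball 0 r"
    then obtain c where A: "A = ?F c" "norm A \<le> r" by auto
    have "?F c \<in> mats d" by (intro sum_mats cunit_mats) simp_all
    with A show "A \<in> {A \<in> mats d. norm A \<le> r}" by simp
  next
    fix A assume A: "A \<in> {A \<in> mats d. norm A \<le> r}"
    let ?c = "\<lambda>ij. entry A (fst ij) (snd ij)"
    have "cmod (?c ij) \<le> r" for ij
      using A norm_entry_le[of A "fst ij" "snd ij"] by simp
    then have c: "?c \<in> ?K" by (simp add: PiE_UNIV_domain)
    have "A = ?F ?c" using A cmat_expand[of A d] by simp
    then have "A \<in> ?F ` ?K" using imageI[OF c, of ?F] by metis
    with A show "A \<in> ?F ` ?K \<inter> cball 0 r" by simp
  qed
  finally show ?thesis .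
qed

text \<open>The first-order condition without derivatives: with k = |c| + 1, the value at t = -b/k
  is b^2 (c - k) / k^2, negative unless b = 0. It serves the eigenvector, the extremal family and
  the Euler equation.\<close>

lemma linear_coefficient_zero:
  fixes b c :: real
  assumes "\<And>t. 0 \<le> t * b + t\<^sup>2 * c"
  shows "b = 0"
proof (rule ccontr)
  assume b: "b \<noteq> 0"
  define k where "k = \<bar>c\<bar> + 1"
  have k: "k > 0" "c < k" by (auto simp: k_def)
  have "0 \<le> (- b / k) * b + (- b / k)\<^sup>2 * c" by (rule assms)
  also have "\<dots> = (b\<^sup>2 / k\<^sup>2) * (c - k)"
    using k(1) by (simp add: field_simps power2_eq_square)
  finally have "0 \<le> (b\<^sup>2 / k\<^sup>2) * (c - k)" .
  moreover have "(b\<^sup>2 / k\<^sup>2) * (c - k) < 0"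
    using b k by (intro mult_pos_neg divide_pos_pos) auto
  ultimately show False by simp
qed

text \<open>Testing with matrices amounts to testing with vectors, since
  \<open>inner W (A * W)\<close> is the sum of the quadratic form over the columns of W.\<close>

definition pos :: "cmat \<Rightarrow> bool" where
  "pos A \<longleftrightarrow> adj A = A \<and> (\<forall>W. 0 \<le> inner W (A * W))"

lemma posD: "pos A \<Longrightarrow> adj A = A" "pos A \<Longrightarrow> 0 \<le> inner W (A * W)"
  by (auto simp: pos_def)

lemma pos_zero [simp]: "pos 0" by (simp add: pos_def)

lemma pos_add: "pos A \<Longrightarrow> pos B \<Longrightarrow> pos (A + B)"
  by (auto simp: pos_def adj_add distrib_right inner_add_right)

lemma pos_sum: "(\<And>k. k \<in> K \<Longrightarrow> pos (F k)) \<Longrightarrow> pos (sum F K)"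
  by (induction K rule: infinite_finite_induct) (auto intro: pos_add)

lemma pos_scaleR: "pos A \<Longrightarrow> 0 \<le> r \<Longrightarrow> pos (r *\<^sub>R A)"
  by (auto simp: pos_def adj_scaleR)

lemma pos_congruence:
  assumes "pos A" shows "pos (adj W * A * W)"
proof -
  have "inner Z (adj W * A * W * Z) = inner (W * Z) (A * (W * Z))" for Z
    by (simp add: inner_mult_left mult.assoc)
  then show ?thesis using assms by (simp add: pos_def adj_mult mult.assoc)
qed

lemma pos_adj_mult: "pos (adj R * R)"
proof -
  have "inner Z (adj R * R * Z) = inner (R * Z) (R * Z)" for Z
    by (simp add: inner_mult_left mult.assoc)
  then show ?thesis by (simp add: pos_def adj_mult)
qed

lemma pos_idm [simp]: "pos (idm d)"
  using pos_adj_mult[of "idm d"] by simp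

lemma rtr_nonneg:
  assumes "pos A" shows "0 \<le> rtr A"
proof -
  obtain d where "A \<in> mats d" using ex_mats by blast
  then show ?thesis using posD(2)[OF assms, of "idm d"] by (simp add: inner_idm)
qed

text \<open>Maximize the quadratic form of A over unit vectors in the range of the projection p.
  Vectors are matrices supported in column 0, expressed by \<open>w * idm 1 = w\<close>.\<close>

lemma eigenvector_in_range:
  assumes A: "A \<in> mats d" "adj A = A" and p: "p \<in> mats d" "adj p = p" "p * p = p" "p \<noteq> 0"
    and pA: "p * A = A" "A * p = A"
  obtains w l where "w \<in> mats d" "w * idm 1 = w" "p * w = w" "adj w * w = idm 1" "A * w = l *\<^sub>R w"
proof -
  let ?W = "{w \<in> mats d. norm w \<le> 1} \<inter> {w. w * idm 1 = w \<and> p * w = w \<and> norm w = 1}"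
  have "closed {w. w * idm 1 = w \<and> p * w = w \<and> norm w = 1}"
    by (intro closed_Collect_conj closed_Collect_eq continuous_intros)
  then have W: "compact ?W" by (intro compact_Int_closed compact_mats_cball)
  obtain i j where ij: "entry p i j \<noteq> 0"
    using p(4) cmat_eqI[of p 0] by auto
  then have ijd: "i < d" "j < d" using mats_nonzeroD[OF p(1)] by auto
  \<comment> \<open>Column j of p moved to column 0; it is nonzero because entry (i, j) of p
    is.\<close>
  let ?w = "p * cunit j 0 1"
  have c1: "cunit j 0 1 * idm 1 = cunit j 0 1"
    by (rule cmat_eqI) (auto simp: entry_mult[of _ 1])
  have "entry ?w i 0 = entry p i j"
    using p(1) ijd by (simp add: entry_mult[of _ d] if_distrib[of "\<lambda>x. _ * x"] cong: if_cong)
  then have w0: "?w \<noteq> 0" using ij by auto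
  have "d > 0" using ijd by simp
  then have "?w \<in> mats d" using p(1) ijd by (intro mult_mats cunit_mats) auto
  then have "inverse (norm ?w) *\<^sub>R ?w \<in> ?W"
    using w0 c1 p(3) by (auto simp: mult.assoc[symmetric]) (simp_all add: mult.assoc)
  then have "?W \<noteq> {}" by blast
  moreover have "continuous_on ?W (\<lambda>w. inner w (A * w))" by (intro continuous_intros)
  ultimately obtain w where w: "w \<in> ?W" and max: "\<And>z. z \<in> ?W \<Longrightarrow> inner z (A * z) \<le> inner w (A * w)"
    using continuous_attains_sup[OF W] by blast
  define l where "l = inner w (A * w)"
  define B where "B = l *\<^sub>R p - A"
  have wW: "w \<in> mats d" "w * idm 1 = w" "p * w = w" "norm w = 1" using w by auto
  have ge: "0 \<le> inner z (B * z)" if z: "z \<in> mats d" "z * idm 1 = z" "p * z = z" for z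
  proof (cases "z = 0")
    case False
    have "inverse (norm z) *\<^sub>R z \<in> ?W" using z False by auto
    from max[OF this] have "inverse (norm z) * (inverse (norm z) * inner z (A * z)) \<le> l"
      by (simp add: l_def)
    then have "inner z (A * z) \<le> l * (norm z)\<^sup>2"
      using False by (simp add: field_simps power2_eq_square)
    then show ?thesis
      using z by (simp add: B_def left_diff_distrib inner_diff_right power2_norm_eq_inner)
  qed simp
  have Bw: "inner w (B * w) = 0"
    using wW by (simp add: B_def left_diff_distrib inner_diff_right l_def norm_eq_1)
  \<comment> \<open>B is nonnegative on the range of p and its form vanishes at w. Moving w towards
    z gives the linear coefficient 2 |z|^2, so z = 0.\<close>
  define z where "z = B * w"
  have Bm: "B \<in> mats d" using A p by (simp add: B_def)
  have adjB: "adj B = B" using A p by (simp add: B_def adj_diff adj_scaleR)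
  have pB: "p * B = B" using p pA by (simp add: B_def right_diff_distrib)
  have z: "z \<in> mats d" "z * idm 1 = z" "p * z = z"
    using wW Bm pB by (simp_all add: z_def mult.assoc) (simp add: mult.assoc[symmetric])
  have "0 \<le> t * (2 * inner z z) + t\<^sup>2 * inner z (B * z)" for t :: real
  proof -
    have "0 \<le> inner (w + t *\<^sub>R z) (B * (w + t *\<^sub>R z))"
      using z wW by (intro ge) (auto simp: algebra_simps)
    also have "\<dots> = inner w (B * w) + t * (inner w (B * z) + inner z (B * w)) + t\<^sup>2 * inner z (B * z)"
      by (simp add: distrib_left inner_add_left inner_add_right power2_eq_square algebra_simps)
    also have "inner w (B * z) = inner z z"
      using inner_mult_left[of B w z] adjB by (simp add: z_def)
    finally show ?thesis using Bw by (simp add: z_def)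
  qed
  from linear_coefficient_zero[OF this] have "z = 0" by simp
  then have Aw: "A * w = l *\<^sub>R w" using wW by (simp add: z_def B_def left_diff_distrib)
  have col: "entry w i j = 0" if "0 < j" for i j
  proof -
    have "entry (w * idm 1) i j = 0" using that by (simp add: entry_mult[of _ 1])
    then show ?thesis using wW(2) by simp
  qed
  have "adj w * w = idm 1"
  proof (rule cmat_eqI)
    fix i j
    have "inner w w = (\<Sum>k<d. (cmod (entry w k 0))\<^sup>2)"
    proof -
      have "(\<Sum>j<d. (cmod (entry w k j))\<^sup>2) = (\<Sum>j\<in>{0}. (cmod (entry w k j))\<^sup>2)" for k
        using \<open>d > 0\<close> col by (intro sum.mono_neutral_right) auto
      then show ?thesis using wW(1) by (simp add: inner_self_cmat[of _ d])
    qed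
    then have s: "(\<Sum>k<d. (cmod (entry w k 0))\<^sup>2) = 1" using wW(4) by (simp add: norm_eq_1)
    have sq: "z * cnj z = (complex_of_real (cmod z))\<^sup>2" for z
      by (metis complex_norm_square of_real_power)
    have "entry (adj w * w) 0 0 = complex_of_real (\<Sum>k<d. (cmod (entry w k 0))\<^sup>2)"
      using wW(1) by (simp add: entry_mult[of _ d] sq mult.commute[of "cnj _"])
    then have "entry (adj w * w) 0 0 = 1" using s by simp
    moreover have "entry (adj w * w) i j = 0" if "0 < i \<or> 0 < j"
      using that col wW(1) by (auto simp: entry_mult[of _ d])
    ultimately show "entry (adj w * w) i j = entry (idm 1) i j"
      by (cases "i = 0 \<and> j = 0") auto
  qed
  with wW Aw show ?thesis using that by blast
qed

text \<open>Pairwise orthogonal nonzero projections. Their sum is prescribed separately, because the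
  induction below resolves projections p smaller than \<open>idm d\<close>.\<close>

definition resolution :: "nat \<Rightarrow> nat \<Rightarrow> (nat \<Rightarrow> cmat) \<Rightarrow> bool" where
  "resolution d m E \<longleftrightarrow>
     (\<forall>i<m. E i \<in> mats d \<and> adj (E i) = E i \<and> E i \<noteq> 0) \<and>
     (\<forall>i<m. \<forall>j<m. E i * E j = (if i = j then E i else 0))"

text \<open>The coefficient depends on the index and not on an eigenvalue, so repeated eigenvalues
  need no merging.\<close>

definition fcalc :: "nat \<Rightarrow> (nat \<Rightarrow> cmat) \<Rightarrow> (nat \<Rightarrow> real) \<Rightarrow> cmat" where
  "fcalc m E \<phi> = (\<Sum>i<m. \<phi> i *\<^sub>R E i)"

lemma fcalc_cong: "(\<And>i. i < m \<Longrightarrow> \<phi> i = \<psi> i) \<Longrightarrow> fcalc m E \<phi> = fcalc m E \<psi>"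
  by (simp add: fcalc_def)

text \<open>Induction on a bound for the rank \<open>rtr p\<close>: the projection F onto an
  eigenvector has trace 1, and A - l F again lives under the projection p - F.\<close>

lemma spectral_step:
  assumes "p \<in> mats d" "adj p = p" "p * p = p" "A \<in> mats d" "adj A = A" "p * A = A" "A * p = A"
    and "rtr p \<le> real n"
  shows "\<exists>m E l. resolution d m E \<and> p = (\<Sum>i<m. E i) \<and> A = fcalc m E l"
  using assms
proof (induction n arbitrary: p A)
  case 0
  have "(norm p)\<^sup>2 \<le> 0" using "0.prems" by (simp add: norm_sq_rtr)
  then have "p = 0" by simp
  then have "A = 0" using "0.prems" by simp
  with \<open>p = 0\<close> have "resolution d 0 (\<lambda>_. 0) \<and> p = (\<Sum>i<0. 0) \<and> A = fcalc 0 (\<lambda>_. 0) (\<lambda>_. 0)"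
    by (simp add: resolution_def fcalc_def)
  then show ?case by blast
next
  case (Suc n)
  show ?case
  proof (cases "p = 0")
    case True
    then have "A = 0" using Suc.prems by simp
    with True have "resolution d 0 (\<lambda>_. 0) \<and> p = (\<Sum>i<0. 0) \<and> A = fcalc 0 (\<lambda>_. 0) (\<lambda>_. 0)"
      by (simp add: resolution_def fcalc_def)
    then show ?thesis by blast
  next
    case False
    obtain w l where w: "w \<in> mats d" "w * idm 1 = w" "p * w = w" "adj w * w = idm 1" "A * w = l *\<^sub>R w"
      using eigenvector_in_range[of A d p] Suc.prems False by blast
    define F where "F = w * adj w"
    have F: "F \<in> mats d" "adj F = F" using w(1) by (simp_all add: F_def adj_mult)
    have "F * F = w * (adj w * w) * adj w" by (simp add: F_def mult.assoc)
    then have FF: "F * F = F" using w(2,4) by (simp add: F_def)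
    have pF: "p * F = F" using w(3) by (simp add: F_def mult.assoc[symmetric])
    have "adj (p * F) = adj F" using pF by simp
    then have Fp: "F * p = F" using F(2) Suc.prems(2) by (simp add: adj_mult)
    have AF: "A * F = l *\<^sub>R F" using w(5) by (simp add: F_def mult.assoc[symmetric])
    have "adj (A * F) = adj (l *\<^sub>R F)" using AF by simp
    then have FA: "F * A = l *\<^sub>R F" using F(2) Suc.prems(5) by (simp add: adj_mult adj_scaleR)
    have trF: "rtr F = 1" using w(4) by (simp add: F_def rtr_commute[of w])
    then have F0: "F \<noteq> 0" by auto
    let ?p = "p - F" and ?A = "A - l *\<^sub>R F"
    have "\<exists>m E k. resolution d m E \<and> ?p = (\<Sum>i<m. E i) \<and> ?A = fcalc m E k"
    proof (rule Suc.IH)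
      show "?p \<in> mats d" "?A \<in> mats d" using Suc.prems F by simp_all
      show "adj ?p = ?p" "adj ?A = ?A" using Suc.prems F by (simp_all add: adj_diff adj_scaleR)
      show "?p * ?p = ?p"
        using Suc.prems(3) FF pF Fp by (simp add: left_diff_distrib right_diff_distrib)
      show "?p * ?A = ?A" "?A * ?p = ?A"
        using Suc.prems(6,7) FF pF Fp AF FA by (simp_all add: left_diff_distrib right_diff_distrib)
      show "rtr ?p \<le> real n" using Suc.prems(8) trF by (simp add: rtr_diff)
    qed
    then obtain m E k where IH: "resolution d m E" "?p = (\<Sum>i<m. E i)" "?A = fcalc m E k"
      by blast
    have E: "E i \<in> mats d" "adj (E i) = E i" "E i \<noteq> 0" if "i < m" for i
      using IH(1) that by (auto simp: resolution_def)
    have EE: "E i * E j = (if i = j then E i else 0)" if "i < m" "j < m" for i j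
      using IH(1) that by (auto simp: resolution_def)
    have "E i * ?p = E i" if "i < m" for i
    proof -
      have "E i * ?p = (\<Sum>j<m. if i = j then E i else 0)"
        unfolding IH(2) sum_distrib_left using that EE by (intro sum.cong) auto
      then show ?thesis using that by simp
    qed
    moreover have "?p * F = 0" using FF pF by (simp add: left_diff_distrib)
    ultimately have EF: "E i * F = 0" if "i < m" for i
      using that mult.assoc[of "E i" ?p F] by simp
    have FE: "F * E i = 0" if "i < m" for i
    proof -
      have "adj (E i * F) = 0" using EF that by simp
      then show ?thesis using E(2) F(2) that by (simp add: adj_mult)
    qed
    let ?E = "E(m := F)" and ?k = "k(m := l)"
    have "resolution d (Suc m) ?E"
      using E EE EF FE F F0 FF by (auto simp: resolution_def less_Suc_eq)
    moreover have "p = (\<Sum>i<Suc m. ?E i)" using IH(2) by (simp add: algebra_simps)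
    moreover have "A = fcalc (Suc m) ?E ?k" using IH(3) by (simp add: fcalc_def algebra_simps)
    ultimately show ?thesis by blast
  qed
qed

theorem spectral_theorem:
  assumes "A \<in> mats d" "adj A = A"
  obtains m E l where "resolution d m E" "idm d = fcalc m E (\<lambda>_. 1)" "A = fcalc m E l"
  using spectral_step[of "idm d" d A d] assms by (auto simp: fcalc_def)

section \<open>Functional calculus and positive square roots\<close>

context
  fixes d m E
  assumes res: "resolution d m E"
begin

lemma fcalc_mats: "fcalc m E \<phi> \<in> mats d"
  unfolding fcalc_def using res by (intro sum_mats scaleR_mats) (simp add: resolution_def)

lemma adj_fcalc: "adj (fcalc m E \<phi>) = fcalc m E \<phi>"
  using res by (auto simp: fcalc_def resolution_def adj_sum adj_scaleR)

lemma fcalc_mult: "fcalc m E \<phi> * fcalc m E \<psi> = fcalc m E (\<lambda>i. \<phi> i * \<psi> i)"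
proof -
  have "fcalc m E \<phi> * fcalc m E \<psi> = (\<Sum>i<m. \<Sum>j<m. (\<phi> i * \<psi> j) *\<^sub>R (E i * E j))"
    by (simp add: fcalc_def sum_product mult.commute)
  also have "\<dots> = (\<Sum>i<m. \<Sum>j<m. if i = j then (\<phi> i * \<psi> i) *\<^sub>R E i else 0)"
    using res by (intro sum.cong refl) (auto simp: resolution_def)
  finally show ?thesis by (simp add: fcalc_def)
qed

lemma pos_fcalc:
  assumes "\<And>i. i < m \<Longrightarrow> 0 \<le> \<phi> i"
  shows "pos (fcalc m E \<phi>)"
  unfolding fcalc_def
proof (rule pos_sum)
  fix i assume i: "i \<in> {..<m}"
  then have "E i = adj (E i) * E i" using res by (auto simp: resolution_def)
  then have "pos (E i)" by (metis pos_adj_mult)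
  then show "pos (\<phi> i *\<^sub>R E i)" using i assms by (intro pos_scaleR) auto
qed

text \<open>Testing positivity with the nonzero projection \<open>E i\<close> isolates its
  coefficient.\<close>

lemma fcalc_coeff_nonneg:
  assumes "pos (fcalc m E \<phi>)" "i < m"
  shows "0 \<le> \<phi> i"
proof -
  have "fcalc m E \<phi> * E i = (\<Sum>j<m. if j = i then \<phi> i *\<^sub>R E i else 0)"
    unfolding fcalc_def sum_distrib_right using res assms(2)
    by (intro sum.cong refl) (auto simp: resolution_def)
  then have "fcalc m E \<phi> * E i = \<phi> i *\<^sub>R E i" using assms(2) by simp
  then have "0 \<le> \<phi> i * inner (E i) (E i)"
    using posD(2)[OF assms(1), of "E i"] by simp
  moreover have "inner (E i) (E i) > 0" using res assms(2) by (auto simp: resolution_def)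
  ultimately show ?thesis by (simp add: zero_le_mult_iff)
qed

end

lemma pos_sqrt_exists:
  assumes "A \<in> mats d" "pos A"
  shows "\<exists>B\<in>mats d. pos B \<and> B * B = A"
proof -
  obtain m E l where E: "resolution d m E" "A = fcalc m E l"
    using spectral_theorem[OF assms(1) posD(1)[OF assms(2)]] by blast
  then have l: "0 \<le> l i" if "i < m" for i using fcalc_coeff_nonneg assms(2) that by blast
  let ?B = "fcalc m E (\<lambda>i. sqrt (l i))"
  have "?B * ?B = A"
    unfolding fcalc_mult[OF E(1)] E(2) using l by (simp add: fcalc_def)
  then show ?thesis
    using fcalc_mats[OF E(1)] pos_fcalc[OF E(1), of "\<lambda>i. sqrt (l i)"] l by auto
qed

text \<open>With A = B * B the form is the squared norm of B * W.\<close>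

lemma pos_null:
  assumes "pos A" "inner W (A * W) = 0"
  shows "A * W = 0"
proof -
  obtain d where "A \<in> mats d" using ex_mats by blast
  then obtain B where B: "pos B" "B * B = A" using pos_sqrt_exists assms(1) by blast
  then have "inner (B * W) (B * W) = 0"
    using assms(2) by (simp add: inner_mult_left posD(1) mult.assoc[symmetric])
  then show ?thesis using B(2) by (metis inner_eq_zero_iff mult.assoc mult_zero_right)
qed

text \<open>For X = B - C, X(B + C) + (B + C)X = 2(B^2 - C^2) = 0, so by cyclicity the trace of X(B
  + C)X equals its own negative. Its two nonnegative parts vanish, hence BX = CX = 0 and X^2 =
  0.\<close>

lemma pos_sqrt_unique:
  assumes "pos B" "pos C" "B * B = C * C"
  shows "B = C"
proof -
  define X where "X = B - C"
  have aX: "adj X = X" using assms by (simp add: X_def adj_diff posD(1))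
  have "X * (B + C) + (B + C) * X = (B * B - C * C) + (B * B - C * C)"
    by (simp add: X_def algebra_simps)
  then have "(B + C) * X = - (X * (B + C))"
    using assms(3) by (simp add: add_eq_0_iff)
  then have "rtr (X * ((B + C) * X)) = - rtr (X * (X * (B + C)))"
    by (simp add: rtr_uminus)
  also have "rtr (X * (X * (B + C))) = rtr (X * ((B + C) * X))"
    using rtr_commute[of X "X * (B + C)"] by (simp add: mult.assoc)
  finally have "rtr (X * ((B + C) * X)) = 0" by simp
  then have "inner X (B * X) + inner X (C * X) = 0"
    using aX by (simp add: inner_cmat_def mult.assoc distrib_left distrib_right rtr_add)
  then have "inner X (B * X) = 0" "inner X (C * X) = 0"
    using posD(2)[OF assms(1), of X] posD(2)[OF assms(2), of X] by linarith+
  then have "B * X = 0" "C * X = 0" using assms pos_null by auto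
  then have "X * X = 0" by (simp add: X_def left_diff_distrib)
  then have "inner X X = 0" using aX by (simp add: inner_cmat_def)
  then show ?thesis by (simp add: X_def)
qed

definition csqrt_mat :: "cmat \<Rightarrow> cmat" where
  "csqrt_mat A = (THE B. pos B \<and> B * B = A)"

lemma csqrt_mat_eq: "pos B \<Longrightarrow> B * B = A \<Longrightarrow> csqrt_mat A = B"
  unfolding csqrt_mat_def by (rule the_equality) (auto intro: pos_sqrt_unique)

lemma csqrt_mat:
  assumes "pos A"
  shows pos_csqrt_mat: "pos (csqrt_mat A)" and csqrt_mat_square: "csqrt_mat A * csqrt_mat A = A"
    and csqrt_mat_mats: "A \<in> mats d \<Longrightarrow> csqrt_mat A \<in> mats d"
proof -
  obtain e where e: "A \<in> mats e" using ex_mats by blast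
  from pos_sqrt_exists[OF e assms] obtain B where B: "pos B" "B * B = A" by blast
  with csqrt_mat_eq show "pos (csqrt_mat A)" "csqrt_mat A * csqrt_mat A = A" by auto
  assume "A \<in> mats d"
  from pos_sqrt_exists[OF this assms] show "csqrt_mat A \<in> mats d" using csqrt_mat_eq by auto
qed

subsection \<open>Absolute values and the trace norm\<close>

definition absm :: "cmat \<Rightarrow> cmat" where
  "absm S = csqrt_mat (adj S * S)"

definition tnorm :: "cmat \<Rightarrow> real" where
  "tnorm S = rtr (absm S)"

lemma pos_absm: "pos (absm S)"
  by (simp add: absm_def pos_csqrt_mat pos_adj_mult)

lemma adj_absm [simp]: "adj (absm S) = absm S"
  by (rule posD(1)[OF pos_absm])

lemma absm_square: "absm S * absm S = adj S * S"
  by (simp add: absm_def csqrt_mat_square pos_adj_mult)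

lemma absm_mats [simp]: "S \<in> mats d \<Longrightarrow> absm S \<in> mats d"
  by (simp add: absm_def csqrt_mat_mats pos_adj_mult)

lemma norm_absm: "norm (absm S) = norm S"
  by (simp add: norm_eq_sqrt_inner inner_cmat_def absm_square)

lemma absm_scaleR: "absm (r *\<^sub>R S) = \<bar>r\<bar> *\<^sub>R absm S"
  unfolding absm_def[of "r *\<^sub>R S"]
  by (rule csqrt_mat_eq) (simp_all add: pos_scaleR pos_absm adj_scaleR absm_square)

lemma absm_uminus [simp]: "absm (- S) = absm S"
  using absm_scaleR[of "-1" S] by simp

lemma tnorm_nonneg [simp]: "0 \<le> tnorm S"
  by (simp add: tnorm_def rtr_nonneg pos_absm)

lemma tnorm_scaleR: "tnorm (r *\<^sub>R S) = \<bar>r\<bar> * tnorm S"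
  by (simp add: tnorm_def absm_scaleR rtr_scaleR)

lemma tnorm_uminus [simp]: "tnorm (- S) = tnorm S"
  by (simp add: tnorm_def)

text \<open>U = S h with h the pseudo-inverse of |S|. It is a partial isometry whose initial
  projection \<open>adj U * U\<close> is the support projection of |S|.\<close>

lemma polar_decomposition:
  assumes S: "S \<in> mats d"
  obtains U where "U \<in> mats d" "U * absm S = S" "adj U * S = absm S"
    "absm (adj S) = U * absm S * adj U" "\<And>W. norm (adj U * W) \<le> norm W"
proof -
  let ?f = "absm S"
  obtain m E s where E: "resolution d m E" and idm: "idm d = fcalc m E (\<lambda>_. 1)" and f: "?f = fcalc m E s"
    using spectral_theorem[of ?f d] S by auto
  \<comment> \<open>Since \<open>inverse 0 = 0\<close>, h inverts |S| on its support and vanishes on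
    the kernel; \<open>inverse (s i) * s i\<close> is the indicator of the support.\<close>
  define h where "h = fcalc m E (\<lambda>i. inverse (s i))"
  define p where "p = fcalc m E (\<lambda>i. inverse (s i) * s i)"
  have hf: "h * ?f = p" by (simp add: h_def p_def f fcalc_mult[OF E])
  have inv: "inverse r * r * r = r" "r * (inverse r * r) = r" "inverse r * (inverse r * r) = inverse r"
    "inverse r * r * (inverse r * r) = inverse r * r" for r :: real
    by (cases "r = 0"; simp)+
  have pf: "p * ?f = ?f" unfolding p_def f fcalc_mult[OF E] by (simp only: inv)
  have fp: "?f * p = ?f" unfolding p_def f fcalc_mult[OF E] by (simp only: inv)
  have hp: "h * p = h" unfolding p_def h_def fcalc_mult[OF E] by (simp only: inv)
  have fh: "?f * h = p" by (simp add: h_def p_def f fcalc_mult[OF E] mult.commute)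
  have pp: "p * p = p"
    unfolding p_def fcalc_mult[OF E] by (simp only: inv)
  have h: "h \<in> mats d" "adj h = h" and p: "p \<in> mats d" "adj p = p"
    by (auto simp: h_def p_def fcalc_mats[OF E] adj_fcalc[OF E])
  define U where "U = S * h"
  have U: "U \<in> mats d" using S h by (simp add: U_def)
  \<comment> \<open>q projects onto the kernel of |S|, which is also the kernel of S because |S|^2 =
    \<open>adj S * S\<close>.\<close>
  define q where "q = idm d - p"
  have "?f * q = 0" using fp S by (simp add: q_def right_diff_distrib)
  then have "adj q * (adj S * S) * q = 0"
    by (simp add: absm_square[symmetric] mult.assoc)
  then have "norm (S * q) = 0"
    by (simp add: norm_eq_sqrt_inner inner_cmat_def adj_mult mult.assoc)
  then have Sp: "S * p = S" using S by (simp add: q_def right_diff_distrib)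
  have UfS: "U * ?f = S" using Sp hf by (simp add: U_def mult.assoc)
  have "adj U * S = h * (?f * ?f)" using h by (simp add: U_def adj_mult absm_square mult.assoc)
  then have US: "adj U * S = ?f" using hf pf by (simp add: mult.assoc[symmetric])
  have UU: "adj U * U = p" using US fh by (simp add: U_def mult.assoc[symmetric])
  have Up: "U * p = U" using hp by (simp add: U_def mult.assoc)
  have g: "absm (adj S) = U * ?f * adj U"
    unfolding absm_def[of "adj S"]
  proof (rule csqrt_mat_eq)
    show "pos (U * ?f * adj U)" using pos_congruence[OF pos_absm[of S], of "adj U"] by simp
    have "U * ?f * adj U * (U * ?f * adj U) = (U * ?f) * (adj U * U) * (?f * adj U)"
      by (simp add: mult.assoc)
    also have "\<dots> = U * (?f * p) * ?f * adj U" by (simp add: UU mult.assoc)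
    also have "\<dots> = (U * ?f) * (?f * adj U)" by (simp only: fp mult.assoc)
    also have "?f * adj U = adj (U * ?f)" by (simp add: adj_mult)
    also have "(U * ?f) * adj (U * ?f) = adj (adj S) * adj S" by (simp add: UfS)
    finally show "U * ?f * adj U * (U * ?f * adj U) = adj (adj S) * adj S" .
  qed
  have "norm (adj U * W) \<le> norm W" for W
  proof -
    \<comment> \<open>R is a projection, and both |\<open>adj U * W\<close>|^2 and |R W|^2 equal the
      form of R at W.\<close>
    define R where "R = U * adj U"
    have "R * R = U * (adj U * U) * adj U" by (simp add: R_def mult.assoc)
    then have RR: "R * R = R" using Up by (simp add: UU R_def)
    have Ra: "adj R = R" by (simp add: R_def adj_mult)
    have 1: "(norm (adj U * W))\<^sup>2 = inner W (R * W)"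
      by (simp add: power2_norm_eq_inner inner_mult_left R_def mult.assoc)
    have 2: "(norm (R * W))\<^sup>2 = inner W (R * W)"
      by (simp add: power2_norm_eq_inner inner_mult_left Ra RR mult.assoc[symmetric])
    have "inner W (R * W) \<le> norm W * norm (R * W)" by (rule norm_cauchy_schwarz)
    then have "norm (R * W) * norm (R * W) \<le> norm W * norm (R * W)"
      using 2 by (simp add: power2_eq_square)
    then have "norm (R * W) \<le> norm W"
      by (cases "R * W = 0") (auto simp: mult_le_cancel_right)
    then have "(norm (R * W))\<^sup>2 \<le> (norm W)\<^sup>2" by (intro power_mono) auto
    with 1 2 have "(norm (adj U * W))\<^sup>2 \<le> (norm W)\<^sup>2" by simp
    then show ?thesis by (rule power2_le_imp_le) simp
  qed
  with U UfS US g show ?thesis using that by blast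
qed

lemma tnorm_adj [simp]: "tnorm (adj S) = tnorm S"
proof -
  obtain d where "S \<in> mats d" using ex_mats by blast
  then obtain U where "U * absm S = S" "adj U * S = absm S" "absm (adj S) = U * absm S * adj U"
    by (rule polar_decomposition) blast
  then show ?thesis unfolding tnorm_def by (metis rtr_commute)
qed

lemma pos_cauchy:
  assumes "pos f"
  shows "2 * inner X (f * Y) \<le> inner X (f * X) + inner Y (f * Y)"
proof -
  have "0 \<le> inner (X - Y) (f * (X - Y))" by (rule posD(2)[OF assms])
  also have "\<dots> = inner X (f * X) + inner Y (f * Y) - inner X (f * Y) - inner Y (f * X)"
    by (simp add: right_diff_distrib inner_diff_left inner_diff_right)
  also have "inner Y (f * X) = inner X (f * Y)"
    using inner_mult_left[of f Y X] posD(1)[OF assms] by (simp add: inner_commute)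
  finally show ?thesis by simp
qed

text \<open>The 2 x 2 block matrix with diagonal |S|, |S*| and off-diagonal entries -S* and -S is
  positive; this is its form at (W, Z). Polar decomposition reduces it to Cauchy-Schwarz for |S|,
  applied to \<open>adj U * Z\<close> and W.\<close>

lemma absm_block: "2 * inner Z (S * W) \<le> inner W (absm S * W) + inner Z (absm (adj S) * Z)"
proof -
  obtain d where "S \<in> mats d" using ex_mats by blast
  then obtain U where U: "U * absm S = S" "absm (adj S) = U * absm S * adj U"
    by (rule polar_decomposition) blast
  have "2 * inner (adj U * Z) (absm S * W) \<le>
        inner (adj U * Z) (absm S * (adj U * Z)) + inner W (absm S * W)"
    by (rule pos_cauchy[OF pos_absm])
  then show ?thesis using U by (simp add: inner_mult_left mult.assoc[symmetric])
qed

text \<open>Test the block at W = \<open>idm d\<close> and Z = U from the polar decomposition: the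
  left side becomes tr |S|, and U enters the Q term as a contraction. Trace norm bounds thus follow
  from adding or conjugating blocks.\<close>

lemma tnorm_le_block:
  assumes "S \<in> mats d" "P \<in> mats d" "pos Q"
    and block: "\<And>Z W. 2 * inner Z (S * W) \<le> inner W (P * W) + inner Z (Q * Z)"
  shows "2 * tnorm S \<le> rtr P + rtr Q"
proof -
  obtain U where U: "U \<in> mats d" "adj U * S = absm S" "\<And>W. norm (adj U * W) \<le> norm W"
    using polar_decomposition[OF assms(1)] by metis
  have "2 * inner U (S * idm d) \<le> inner (idm d) (P * idm d) + inner U (Q * U)" by (rule block)
  moreover have "inner U (S * idm d) = tnorm S"
    using assms(1) U(2) by (simp add: inner_cmat_def tnorm_def)
  moreover have "inner (idm d) (P * idm d) = rtr P" using assms(2) by (simp add: inner_idm)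
  moreover have "inner U (Q * U) \<le> rtr Q"
  proof -
    let ?q = "csqrt_mat Q"
    have q: "adj ?q = ?q" "?q * ?q = Q" using assms(3) by (auto simp: posD(1) pos_csqrt_mat csqrt_mat_square)
    have "inner U (Q * U) = inner (?q * U) (?q * U)"
      by (simp add: inner_mult_left q mult.assoc[symmetric])
    also have "\<dots> = (norm (adj (?q * U)))\<^sup>2" by (simp add: power2_norm_eq_inner)
    also have "\<dots> \<le> (norm ?q)\<^sup>2"
      using U(3)[of ?q] by (intro power_mono) (auto simp: adj_mult q)
    also have "\<dots> = rtr Q" by (simp add: norm_sq_rtr q)
    finally show ?thesis .
  qed
  ultimately show ?thesis by simp
qed

lemma tnorm_triangle: "tnorm (S + T) \<le> tnorm S + tnorm T"
proof -
  obtain d where d: "S \<in> mats d" "T \<in> mats d" using ex_mats2 by blast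
  have "2 * tnorm (S + T) \<le> rtr (absm S + absm T) + rtr (absm (adj S) + absm (adj T))"
  proof (rule tnorm_le_block[where d = d])
    fix Z W
    show "2 * inner Z ((S + T) * W) \<le> inner W ((absm S + absm T) * W) + inner Z ((absm (adj S) + absm (adj T)) * Z)"
      using absm_block[of Z S W] absm_block[of Z T W] by (simp add: distrib_right inner_add_right)
  qed (use d in \<open>auto intro: pos_add pos_absm\<close>)
  then show ?thesis by (simp add: rtr_add tnorm_def[symmetric])
qed

text \<open>For the square root h of f, |f| <= |h|^2 = tr f in Frobenius norms.\<close>

lemma norm_le_rtr:
  assumes "pos f" shows "norm f \<le> rtr f"
proof -
  let ?h = "csqrt_mat f"
  have h: "adj ?h = ?h" "?h * ?h = f" using assms by (auto simp: posD(1) pos_csqrt_mat csqrt_mat_square)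
  have "norm f \<le> norm ?h * norm ?h" using norm_mult_cmat[of ?h ?h] h by simp
  also have "\<dots> = rtr f" using norm_sq_rtr[of ?h] h by (simp add: power2_eq_square)
  finally show ?thesis .
qed

lemma norm_le_tnorm: "norm S \<le> tnorm S"
  using norm_le_rtr[OF pos_absm, of S] by (simp add: tnorm_def norm_absm)

lemma tnorm_zero [simp]: "tnorm 0 = 0"
  using tnorm_scaleR[of 0 0] by simp

lemma tnorm_le_norm: "S \<in> mats d \<Longrightarrow> tnorm S \<le> sqrt d * norm S"
  using rtr_le_norm[of "absm S" d] by (simp add: tnorm_def norm_absm)

lemma continuous_on_tnorm: "continuous_on (mats d) tnorm"
proof (rule lipschitz_on_continuous_on)
  show "(sqrt (real d))-lipschitz_on (mats d) tnorm"
  proof (rule lipschitz_onI)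
    fix S T assume "S \<in> mats d" "T \<in> mats d"
    then have "tnorm (S - T) \<le> sqrt d * norm (S - T)" by (intro tnorm_le_norm) simp
    moreover have "tnorm S \<le> tnorm T + tnorm (S - T)" using tnorm_triangle[of T "S - T"] by simp
    moreover have "tnorm T \<le> tnorm S + tnorm (S - T)"
      using tnorm_triangle[of S "T - S"] tnorm_uminus[of "S - T"] by simp
    ultimately show "dist (tnorm S) (tnorm T) \<le> sqrt (real d) * dist S T"
      by (simp add: dist_norm)
  qed simp
qed

text \<open>The matrix substitute for the bound \<open>ab \<le> |a||b|\<close>: polar decomposition splits \<open>inner A B\<close> evenly between the
  left and the right absolute values.\<close>

lemma inner_le_absm: "2 * inner A B \<le> inner (absm A) (absm B) + inner (absm (adj A)) (absm (adj B))"
proof -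
  obtain d where "A \<in> mats d" using ex_mats by blast
  then obtain U where U: "U * absm A = A" "absm (adj A) = U * absm A * adj U"
    by (rule polar_decomposition) blast
  let ?h = "csqrt_mat (absm A)"
  have h: "adj ?h = ?h" "?h * ?h = absm A"
    using pos_absm by (auto simp: posD(1) pos_csqrt_mat csqrt_mat_square)
  \<comment> \<open>The block of B is tested at W = |A|^(1/2) and Z = U |A|^(1/2), for which
    \<open>W * adj W\<close> is |A| and \<open>Z * adj Z\<close> is |A*|.\<close>
  have "2 * inner (U * ?h) (B * ?h) \<le> inner ?h (absm B * ?h) + inner (U * ?h) (absm (adj B) * (U * ?h))"
    by (rule absm_block)
  moreover have "inner (U * ?h) (B * ?h) = inner A B"
    by (simp add: inner_mult_right[symmetric] inner_commute[of _ "B * ?h"] h)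
       (simp add: inner_mult_right h mult.assoc U inner_commute)
  moreover have "inner ?h (absm B * ?h) = inner (absm A) (absm B)"
    using inner_mult_right[of "absm B" ?h ?h] by (simp add: inner_commute h)
  moreover have "inner (U * ?h) (absm (adj B) * (U * ?h)) = inner (absm (adj A)) (absm (adj B))"
  proof -
    have "(U * ?h) * adj (U * ?h) = absm (adj A)"
      using h by (simp add: adj_mult U(2) mult.assoc) (simp add: mult.assoc[symmetric])
    then show ?thesis
      using inner_mult_right[of "absm (adj B)" "U * ?h" "U * ?h"] by (simp add: inner_commute)
  qed
  ultimately show ?thesis by simp
qed

text \<open>The matrix form of 2 f <= f^2 / c + c, from expanding the form of ci at f - c. It bounds
  \<open>rtr f\<close> by an expression affine in f^2, with equality at f = c.\<close>

lemma rtr_variational: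
  assumes "pos f" "pos c" "pos ci" "c * ci = idm d" "f \<in> mats d" "c \<in> mats d"
  shows "2 * rtr f \<le> rtr (ci * (f * f)) + rtr c"
proof -
  have "ci * c = adj (c * ci)"
    by (simp add: adj_mult posD(1)[OF assms(2)] posD(1)[OF assms(3)])
  then have cic: "ci * c = idm d" using assms(4) by simp
  have "0 \<le> inner (f - c) (ci * (f - c))" by (rule posD(2)[OF assms(3)])
  also have "\<dots> = rtr ((f - c) * (ci * (f - c)))"
    by (simp add: inner_cmat_def adj_diff posD(1)[OF assms(1)] posD(1)[OF assms(2)])
  also have "(f - c) * (ci * (f - c)) = f * (ci * f) - f * (ci * c) - (c * ci) * f + c * (ci * c)"
    by (simp add: algebra_simps)
  also have "rtr (f * (ci * f) - f * (ci * c) - (c * ci) * f + c * (ci * c)) = rtr (f * (ci * f)) - 2 * rtr f + rtr c"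
    using assms cic by (simp add: rtr_add rtr_diff)
  also have "rtr (f * (ci * f)) = rtr (ci * (f * f))"
    using rtr_commute[of f "ci * f"] by (simp add: mult.assoc)
  finally show ?thesis by simp
qed

text \<open>One spectral resolution of T carries all matrices involved, so the claims reduce to sqrt
  l <= sqrt (l + e^2) <= sqrt l + e and sqrt (l + e^2) >= e for l >= 0.\<close>

lemma regularized_sqrt:
  assumes T: "T \<in> mats d" "pos T" and e: "0 < e"
  defines "c \<equiv> csqrt_mat (T + e\<^sup>2 *\<^sub>R idm d)"
  obtains ci where "c \<in> mats d" "pos c" "c * c = T + e\<^sup>2 *\<^sub>R idm d"
    "rtr (csqrt_mat T) \<le> rtr c" "rtr c \<le> rtr (csqrt_mat T) + e * d"
    "ci \<in> mats d" "pos ci" "c * ci = idm d" "ci * c = idm d" "rtr ci \<le> d / e"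
proof -
  obtain m E l where E: "resolution d m E" and idm: "idm d = fcalc m E (\<lambda>_. 1)" and l: "T = fcalc m E l"
    using spectral_theorem[OF T(1) posD(1)[OF T(2)]] by blast
  have l0: "0 \<le> l i" if "i < m" for i using fcalc_coeff_nonneg[OF E] T(2) l that by metis
  have Te: "T + e\<^sup>2 *\<^sub>R idm d = fcalc m E (\<lambda>i. l i + e\<^sup>2)"
    by (simp add: l idm fcalc_def scaleR_left_distrib sum.distrib scaleR_sum_right)
  have sT: "csqrt_mat T = fcalc m E (\<lambda>i. sqrt (l i))"
  proof (rule csqrt_mat_eq)
    show "pos (fcalc m E (\<lambda>i. sqrt (l i)))" using l0 by (intro pos_fcalc[OF E]) auto
    show "fcalc m E (\<lambda>i. sqrt (l i)) * fcalc m E (\<lambda>i. sqrt (l i)) = T"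
      unfolding fcalc_mult[OF E] l using l0 by (simp add: fcalc_def)
  qed
  let ?g = "\<lambda>i. sqrt (l i + e\<^sup>2)"
  have ge: "e \<le> ?g i" "0 < ?g i" if "i < m" for i
  proof -
    show "e \<le> ?g i" using l0[OF that] by (intro real_le_rsqrt) simp
    then show "0 < ?g i" using e by linarith
  qed
  have gg: "?g i * ?g i = l i + e\<^sup>2" if "i < m" for i using l0[OF that] by simp
  have cc: "fcalc m E ?g * fcalc m E ?g = T + e\<^sup>2 *\<^sub>R idm d"
    unfolding fcalc_mult[OF E] Te by (rule fcalc_cong) (rule gg)
  have pc: "pos (fcalc m E ?g)" using ge(2) by (intro pos_fcalc[OF E]) (auto intro: less_imp_le)
  have c: "c = fcalc m E ?g" unfolding c_def by (rule csqrt_mat_eq[OF pc cc])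
  have dec: "rtr (fcalc m E \<phi>) \<le> rtr (fcalc m E \<psi>)" if "\<And>i. i < m \<Longrightarrow> \<phi> i \<le> \<psi> i" for \<phi> \<psi>
  proof -
    have "0 \<le> rtr (fcalc m E (\<lambda>i. \<psi> i - \<phi> i))"
      using that by (intro rtr_nonneg pos_fcalc[OF E]) auto
    then show ?thesis by (simp add: fcalc_def scaleR_left_diff_distrib sum_subtractf rtr_diff)
  qed
  have const: "rtr (fcalc m E (\<lambda>i. \<phi> i + r)) = rtr (fcalc m E \<phi>) + r * d" for \<phi> r
  proof -
    have "fcalc m E (\<lambda>i. \<phi> i + r) = fcalc m E \<phi> + r *\<^sub>R idm d"
      by (simp add: idm fcalc_def scaleR_left_distrib sum.distrib scaleR_sum_right)
    then show ?thesis by (simp add: rtr_add rtr_scaleR)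
  qed
  let ?ci = "fcalc m E (\<lambda>i. inverse (?g i))"
  show ?thesis
  proof (rule that[of ?ci])
    show "c \<in> mats d" "?ci \<in> mats d" by (simp_all add: c fcalc_mats[OF E])
    show "pos c" "c * c = T + e\<^sup>2 *\<^sub>R idm d" using pc cc c by auto
    show "rtr (csqrt_mat T) \<le> rtr c" unfolding sT c by (rule dec) auto
    have "rtr c \<le> rtr (fcalc m E (\<lambda>i. sqrt (l i) + e))"
      unfolding c using l0 e sqrt_add_le_add_sqrt[of _ "e\<^sup>2"] by (intro dec) fastforce
    then show "rtr c \<le> rtr (csqrt_mat T) + e * d" by (simp add: const sT)
    show "pos ?ci" using ge by (intro pos_fcalc[OF E]) (auto intro: less_imp_le)
    show "c * ?ci = idm d" "?ci * c = idm d"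
      unfolding c idm fcalc_mult[OF E] by (rule fcalc_cong; use ge(2) in force)+
    have "rtr ?ci \<le> rtr (fcalc m E (\<lambda>i. 0 + inverse e))"
      using ge e by (intro dec) (auto intro: le_imp_inverse_le)
    then show "rtr ?ci \<le> d / e" using const[of "\<lambda>_. 0" "inverse e"] by (simp add: fcalc_def divide_inverse mult.commute)
  qed
qed

subsection \<open>Averages over signs\<close>

text \<open>A sign pattern is encoded as the set x of indices with sign -1: averages run over
  \<open>Pow I\<close>, and complementation reverses all signs.\<close>

definition eps :: "'i set \<Rightarrow> 'i \<Rightarrow> real" where
  "eps x k = (if k \<in> x then -1 else 1)"

definition avg :: "'i set \<Rightarrow> ('i set \<Rightarrow> 'a::real_vector) \<Rightarrow> 'a" where
  "avg I F = (1 / 2 ^ card I) *\<^sub>R (\<Sum>x\<in>Pow I. F x)"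

definition rsum :: "'i set \<Rightarrow> ('i \<Rightarrow> 'a::real_vector) \<Rightarrow> 'i set \<Rightarrow> 'a" where
  "rsum I C x = (\<Sum>k\<in>I. eps x k *\<^sub>R C k)"

definition flip :: "'i \<Rightarrow> 'i set \<Rightarrow> 'i set" where
  "flip k x = (if k \<in> x then x - {k} else insert k x)"

definition walsh :: "'i set \<Rightarrow> 'i set \<Rightarrow> real" where
  "walsh A x = (\<Prod>k\<in>A. eps x k)"

definition fhat :: "'i set \<Rightarrow> ('i set \<Rightarrow> 'a::real_vector) \<Rightarrow> 'i set \<Rightarrow> 'a" where
  "fhat I f A = avg I (\<lambda>x. walsh A x *\<^sub>R f x)"

lemma eps_sq [simp]: "eps x k * eps x k = 1" by (simp add: eps_def)
lemma eps_cases: "eps x k = 1 \<or> eps x k = -1" by (simp add: eps_def)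

lemma flip_flip [simp]: "flip k (flip k x) = x" by (auto simp: flip_def)
lemma flip_subset [simp]: "k \<in> I \<Longrightarrow> x \<subseteq> I \<Longrightarrow> flip k x \<subseteq> I" by (auto simp: flip_def)
lemma eps_flip: "eps (flip k x) j = (if j = k then - eps x j else eps x j)"
  by (cases "k \<in> x"; cases "j = k"; simp add: eps_def flip_def)
lemma eps_compl: "j \<in> I \<Longrightarrow> eps (I - x) j = - eps x j" by (simp add: eps_def)

lemma avg_cong: "(\<And>x. x \<in> Pow I \<Longrightarrow> F x = G x) \<Longrightarrow> avg I F = avg I G"
  by (simp add: avg_def)

lemma avg_add: "avg I (\<lambda>x. F x + G x) = avg I F + avg I G"
  by (simp add: avg_def sum.distrib scaleR_right_distrib)

lemma avg_scaleR: "avg I (\<lambda>x. r *\<^sub>R F x) = r *\<^sub>R avg I F"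
  by (simp add: avg_def scaleR_sum_right[symmetric])

lemma avg_mult: "avg I (\<lambda>x. r * F x) = r * (avg I F :: real)"
  using avg_scaleR[of I r F] by simp

lemma avg_sum: "avg I (\<lambda>x. \<Sum>k\<in>K. F k x) = (\<Sum>k\<in>K. avg I (F k))"
  unfolding avg_def by (subst sum.swap) (simp add: scaleR_sum_right)

lemma avg_const: "finite I \<Longrightarrow> avg I (\<lambda>_. c) = c"
  by (simp add: avg_def card_Pow sum_constant_scaleR)

lemma avg_mono: "(\<And>x. x \<in> Pow I \<Longrightarrow> F x \<le> G x) \<Longrightarrow> avg I F \<le> (avg I G :: real)"
  by (auto simp: avg_def intro!: divide_right_mono sum_mono)

lemma avg_nonneg:
  assumes "\<And>x. x \<in> Pow I \<Longrightarrow> 0 \<le> F x"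
  shows "0 \<le> (avg I F :: real)"
  using sum_nonneg[of "Pow I" F] assms by (simp add: avg_def)

lemma avg_scaleR_left: "avg I (\<lambda>x. h x *\<^sub>R c) = avg I h *\<^sub>R c"
  by (simp add: avg_def scaleR_sum_left scaleR_sum_right sum_divide_distrib)

lemma avg_linear: "linear h \<Longrightarrow> h (avg I F) = avg I (\<lambda>x. h (F x))"
  by (simp add: avg_def linear_scale linear_sum)

lemma avg_flip:
  assumes "k \<in> I" shows "avg I (\<lambda>x. F (flip k x)) = avg I F"
  unfolding avg_def using assms
  by (subst sum.reindex_bij_witness[of "Pow I" "flip k" "flip k" "Pow I" F "\<lambda>x. F (flip k x)"]) simp_all

lemma avg_compl: "avg I (\<lambda>x. F (I - x)) = avg I F"
  unfolding avg_def
  by (subst sum.reindex_bij_witness[of "Pow I" "\<lambda>x. I - x" "\<lambda>x. I - x" "Pow I" F "\<lambda>x. F (I - x)"])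
     (auto simp: double_diff)

lemma avg_eps:
  assumes "finite I" "k \<in> I" "l \<in> I"
  shows "avg I (\<lambda>x. eps x k * eps x l) = (if k = l then 1 else 0)"
proof (cases "k = l")
  case False
  have "avg I (\<lambda>x. eps x k * eps x l) = avg I (\<lambda>x. eps (flip k x) k * eps (flip k x) l)"
    using avg_flip[OF assms(2), of "\<lambda>x. eps x k * eps x l"] by simp
  also have "\<dots> = - avg I (\<lambda>x. eps x k * eps x l)"
    using False avg_mult[of I "-1" "\<lambda>x. eps x k * eps x l"] by (simp add: eps_flip)
  finally show ?thesis using False by simp
qed (use assms in \<open>simp add: avg_const\<close>)

text \<open>The sum over A factors into a product of terms \<open>eps x k * eps y k + 1\<close>, and
  an index in which x and y differ contributes 0.\<close>

lemma walsh_orthogonal: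
  assumes "finite I" "x \<in> Pow I" "y \<in> Pow I"
  shows "(\<Sum>A\<in>Pow I. walsh A x * walsh A y) = (if x = y then 2 ^ card I else 0)"
proof -
  have "(\<Sum>A\<in>Pow I. walsh A x * walsh A y) = (\<Prod>k\<in>I. eps x k * eps y k + 1)"
    by (subst prod_add[OF assms(1)]) (simp add: walsh_def prod.distrib)
  also have "\<dots> = (if x = y then 2 ^ card I else 0)"
  proof (cases "x = y")
    case False
    then have "\<exists>k\<in>I. (k \<in> x) \<noteq> (k \<in> y)" using assms by blast
    then obtain k where k: "k \<in> I" "(k \<in> x) \<noteq> (k \<in> y)" by blast
    then have "eps x k * eps y k + 1 = 0" by (cases "k \<in> x") (auto simp: eps_def)
    with k(1) show ?thesis using False assms(1) by (auto intro!: prod_zero)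
  qed simp
  finally show ?thesis .
qed

lemma parseval:
  fixes f g :: "'i set \<Rightarrow> 'a::real_inner"
  assumes "finite I"
  shows "(\<Sum>A\<in>Pow I. inner (fhat I f A) (fhat I g A)) = avg I (\<lambda>x. inner (f x) (g x))"
proof -
  let ?n = "2 ^ card I :: real"
  have "(\<Sum>A\<in>Pow I. inner (fhat I f A) (fhat I g A)) =
        (\<Sum>A\<in>Pow I. \<Sum>x\<in>Pow I. \<Sum>y\<in>Pow I. (1 / ?n) * (1 / ?n) * (walsh A x * walsh A y) * inner (f y) (g x))"
    by (simp add: fhat_def avg_def inner_sum_left inner_sum_right sum_distrib_left mult.assoc mult.left_commute)
  also have "\<dots> = (\<Sum>x\<in>Pow I. \<Sum>y\<in>Pow I. \<Sum>A\<in>Pow I. (1 / ?n) * (1 / ?n) * (walsh A x * walsh A y) * inner (f y) (g x))"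
    by (subst sum.swap) (intro sum.cong refl sum.swap)
  also have "\<dots> = (\<Sum>x\<in>Pow I. \<Sum>y\<in>Pow I. (1 / ?n) * (1 / ?n) * inner (f y) (g x) * (\<Sum>A\<in>Pow I. walsh A x * walsh A y))"
    unfolding sum_distrib_left by (intro sum.cong refl) (simp only: ac_simps)
  also have "\<dots> = (\<Sum>x\<in>Pow I. \<Sum>y\<in>Pow I. if x = y then (1 / ?n) * inner (f x) (g x) else 0)"
    using assms by (intro sum.cong refl) (simp add: walsh_orthogonal)
  also have "\<dots> = avg I (\<lambda>x. inner (f x) (g x))"
    using assms by (simp add: avg_def sum_distrib_left)
  finally show ?thesis .
qed

text \<open>Flipping sign k negates the Walsh function of A exactly when k is in A, so flips act
  diagonally on the coefficients.\<close>

lemma fhat_flip: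
  assumes "finite I" "k \<in> I" "A \<in> Pow I"
  shows "fhat I (\<lambda>x. f (flip k x)) A = (if k \<in> A then -1 else 1) *\<^sub>R fhat I f A"
proof -
  have A: "finite A" using assms finite_subset by auto
  have w: "walsh A x = (if k \<in> A then -1 else 1) * walsh A (flip k x)" for x
  proof (cases "k \<in> A")
    case True
    have "(\<Prod>j\<in>A - {k}. eps (flip k x) j) = (\<Prod>j\<in>A - {k}. eps x j)"
      by (intro prod.cong) (auto simp: eps_flip)
    then show ?thesis
      using True A by (simp add: walsh_def prod.remove[of A k] eps_flip)
  next
    case False
    then have "walsh A (flip k x) = walsh A x"
      unfolding walsh_def by (intro prod.cong) (auto simp: eps_flip)
    with False show ?thesis by simp
  qed
  have "fhat I (\<lambda>x. f (flip k x)) A = avg I (\<lambda>x. (if k \<in> A then -1 else 1) *\<^sub>R (walsh A (flip k x) *\<^sub>R f (flip k x)))"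
    unfolding fhat_def by (intro avg_cong) (subst w, simp)
  also have "\<dots> = (if k \<in> A then -1 else 1) *\<^sub>R fhat I f A"
    unfolding avg_scaleR fhat_def using avg_flip[OF assms(2), of "\<lambda>x. walsh A x *\<^sub>R f x"] by simp
  finally show ?thesis .
qed

lemma fhat_odd_zero:
  fixes f :: "'i set \<Rightarrow> 'a::real_vector"
  assumes "finite I" "\<And>x. x \<in> Pow I \<Longrightarrow> f (I - x) = f x" "A \<in> Pow I" "odd (card A)"
  shows "fhat I f A = 0"
proof -
  have w: "walsh A (I - x) = - walsh A x" for x
  proof -
    have "walsh A (I - x) = (\<Prod>k\<in>A. (-1) * eps x k)"
      unfolding walsh_def using assms(3) by (intro prod.cong) (auto simp: eps_compl)
    also have "\<dots> = (\<Prod>k\<in>A. -1) * walsh A x" by (simp only: prod.distrib walsh_def)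
    finally show ?thesis using assms(4) by simp
  qed
  have "fhat I f A = avg I (\<lambda>x. walsh A (I - x) *\<^sub>R f (I - x))"
    unfolding fhat_def using avg_compl[of I "\<lambda>x. walsh A x *\<^sub>R f x"] by simp
  also have "\<dots> = avg I (\<lambda>x. (-1) *\<^sub>R (walsh A x *\<^sub>R f x))"
    using assms(2) by (intro avg_cong) (simp add: w)
  also have "\<dots> = - fhat I f A" unfolding avg_scaleR fhat_def by simp
  finally have "fhat I f A + fhat I f A = 0" by (simp only: eq_neg_iff_add_eq_0)
  then show ?thesis by (simp add: scaleR_2[symmetric])
qed

text \<open>Even functions have no Walsh coefficients of degree 1, so their spectral gap is 2 instead of 1.\<close>

lemma even_spectral_gap:
  fixes f :: "'i set \<Rightarrow> 'a::real_inner"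
  assumes I: "finite I" and even: "\<And>x. x \<in> Pow I \<Longrightarrow> f (I - x) = f x"
  shows "(\<Sum>k\<in>I. avg I (\<lambda>x. inner (f x) (f (flip k x)))) \<le>
         (real (card I) - 4) * avg I (\<lambda>x. (norm (f x))\<^sup>2) + 4 * (norm (avg I f))\<^sup>2"
proof -
  let ?n = "real (card I)"
  let ?c = "\<lambda>A. (norm (fhat I f A))\<^sup>2"
  have coeff: "(\<Sum>k\<in>I. if k \<in> A then -1 else 1 :: real) = ?n - 2 * real (card A)" if "A \<in> Pow I" for A
  proof -
    have "(\<Sum>k\<in>I. if k \<in> A then -1 else 1 :: real) = (\<Sum>k\<in>I. 1 - 2 * (if k \<in> A then 1 else 0))"
      by (intro sum.cong) auto
    also have "\<dots> = ?n - 2 * (\<Sum>k\<in>I. if k \<in> A then 1 else 0)"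
      by (simp add: sum_subtractf sum_distrib_left)
    also have "(\<Sum>k\<in>I. if k \<in> A then 1 else 0 :: real) = real (card A)"
      using I that by (simp add: sum.If_cases Int_absorb1)
    finally show ?thesis .
  qed
  have "(\<Sum>k\<in>I. avg I (\<lambda>x. inner (f x) (f (flip k x)))) =
        (\<Sum>k\<in>I. \<Sum>A\<in>Pow I. (if k \<in> A then -1 else 1) * ?c A)"
  proof (rule sum.cong[OF refl])
    fix k assume k: "k \<in> I"
    have "avg I (\<lambda>x. inner (f x) (f (flip k x))) =
          (\<Sum>A\<in>Pow I. inner (fhat I f A) (fhat I (\<lambda>x. f (flip k x)) A))"
      by (rule parseval[OF I, symmetric])
    also have "\<dots> = (\<Sum>A\<in>Pow I. (if k \<in> A then -1 else 1) * ?c A)"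
      using I k by (intro sum.cong refl) (simp add: fhat_flip power2_norm_eq_inner)
    finally show "avg I (\<lambda>x. inner (f x) (f (flip k x))) = \<dots>" .
  qed
  also have "\<dots> = (\<Sum>A\<in>Pow I. (\<Sum>k\<in>I. if k \<in> A then -1 else 1) * ?c A)"
    by (subst sum.swap) (simp add: sum_distrib_right)
  also have "\<dots> = (\<Sum>A\<in>Pow I. (?n - 2 * real (card A)) * ?c A)"
    by (intro sum.cong refl) (simp add: coeff)
  \<comment> \<open>The eigenvalue n - 2|A| is n at A = {}, which accounts for the extra 4.
    Coefficients with |A| odd vanish, and the remaining A have |A| >= 2.\<close>
  also have "\<dots> \<le> (\<Sum>A\<in>Pow I. (?n - 4) * ?c A + (if A = {} then 4 * ?c {} else 0))"
  proof (rule sum_mono)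
    fix A assume A: "A \<in> Pow I"
    then have fA: "finite A" using I finite_subset by auto
    show "(?n - 2 * real (card A)) * ?c A \<le> (?n - 4) * ?c A + (if A = {} then 4 * ?c {} else 0)"
    proof (cases "A = {} \<or> odd (card A)")
      case True
      then show ?thesis using fhat_odd_zero[of I f A] I even A by (auto simp: algebra_simps)
    next
      case False
      then have "card A \<noteq> 0" "card A \<noteq> 1" using fA by auto
      then have "2 \<le> card A" by linarith
      then have "(?n - 2 * real (card A)) * ?c A \<le> (?n - 4) * ?c A"
        by (intro mult_right_mono) auto
      then show ?thesis using False by simp
    qed
  qed
  also have "\<dots> = (?n - 4) * (\<Sum>A\<in>Pow I. ?c A) + 4 * ?c {}"
    using I by (simp add: sum.distrib sum_distrib_left)
  also have "(\<Sum>A\<in>Pow I. ?c A) = avg I (\<lambda>x. (norm (f x))\<^sup>2)"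
    using parseval[OF I, of f f] by (simp add: power2_norm_eq_inner)
  also have "fhat I f {} = avg I f" by (simp add: fhat_def walsh_def)
  finally show ?thesis .
qed

section \<open>Rademacher sums under sign changes\<close>

lemma rsum_compl: "rsum I C (I - x) = - rsum I C x"
  by (simp add: rsum_def eps_compl sum_negf)

lemma rsum_flip:
  assumes "finite I" "k \<in> I"
  shows "rsum I C (flip k x) = rsum I C x - (2 * eps x k) *\<^sub>R C k"
proof -
  have "(\<Sum>j\<in>I - {k}. eps (flip k x) j *\<^sub>R C j) = (\<Sum>j\<in>I - {k}. eps x j *\<^sub>R C j)"
    by (intro sum.cong) (auto simp: eps_flip)
  then show ?thesis
    using assms by (simp add: rsum_def sum.remove[of I k] eps_flip scaleR_2[symmetric] algebra_simps)
qed

text \<open>Each flip subtracts twice its own term, so S is an eigenfunction of the sum of all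
  flips, with the degree 1 value of n - 2|A|.\<close>

lemma sum_rsum_flip:
  assumes "finite I"
  shows "(\<Sum>k\<in>I. rsum I C (flip k x)) = (real (card I) - 2) *\<^sub>R rsum I C x"
proof -
  have "(\<Sum>k\<in>I. rsum I C (flip k x)) = (\<Sum>k\<in>I. rsum I C x - (2 * eps x k) *\<^sub>R C k)"
    using assms by (intro sum.cong refl) (simp add: rsum_flip)
  also have "\<dots> = real (card I) *\<^sub>R rsum I C x - (\<Sum>k\<in>I. (2 * eps x k) *\<^sub>R C k)"
    by (simp add: sum_subtractf sum_constant_scaleR)
  also have "(\<Sum>k\<in>I. (2 * eps x k) *\<^sub>R C k) = 2 *\<^sub>R rsum I C x"
    by (simp add: rsum_def scaleR_sum_right)
  finally show ?thesis by (simp add: scaleR_left_diff_distrib)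
qed

text \<open>The Latala--Oleszkiewicz argument, run simultaneously for \<open>|S|\<close> and \<open>|S*|\<close>.\<close>

theorem latala_oleszkiewicz:
  fixes C :: "'i \<Rightarrow> cmat"
  assumes I: "finite I"
  shows "avg I (\<lambda>x. (norm (rsum I C x))\<^sup>2) \<le>
         (norm (avg I (\<lambda>x. absm (rsum I C x))))\<^sup>2 + (norm (avg I (\<lambda>x. absm (adj (rsum I C x)))))\<^sup>2"
proof -
  let ?S = "rsum I C" and ?n = "real (card I)"
  define f where "f = (\<lambda>x. absm (?S x))"
  define g where "g = (\<lambda>x. absm (adj (?S x)))"
  let ?N = "avg I (\<lambda>x. (norm (?S x))\<^sup>2)"
  have even: "f (I - x) = f x" "g (I - x) = g x" for x
    by (simp_all add: f_def g_def rsum_compl adj_uminus)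
  have nf: "avg I (\<lambda>x. (norm (f x))\<^sup>2) = ?N" "avg I (\<lambda>x. (norm (g x))\<^sup>2) = ?N"
    by (simp_all add: f_def g_def norm_absm)
  have "2 * ((?n - 2) * ?N) = (\<Sum>k\<in>I. avg I (\<lambda>x. 2 * inner (?S x) (?S (flip k x))))"
  proof -
    have "(\<Sum>k\<in>I. avg I (\<lambda>x. 2 * inner (?S x) (?S (flip k x)))) =
          avg I (\<lambda>x. 2 * inner (?S x) (\<Sum>k\<in>I. ?S (flip k x)))"
      by (simp add: avg_sum[symmetric] inner_sum_right sum_distrib_left)
    also have "\<dots> = avg I (\<lambda>x. (2 * (?n - 2)) * (norm (?S x))\<^sup>2)"
      by (simp only: sum_rsum_flip[OF I] inner_scaleR_right power2_norm_eq_inner mult.assoc)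
    finally show ?thesis by (simp only: avg_mult)
  qed
  also have "\<dots> \<le> (\<Sum>k\<in>I. avg I (\<lambda>x. inner (f x) (f (flip k x)) + inner (g x) (g (flip k x))))"
    unfolding f_def g_def by (intro sum_mono avg_mono inner_le_absm)
  also have "\<dots> = (\<Sum>k\<in>I. avg I (\<lambda>x. inner (f x) (f (flip k x)))) + (\<Sum>k\<in>I. avg I (\<lambda>x. inner (g x) (g (flip k x))))"
    by (simp add: avg_add sum.distrib)
  also have "\<dots> \<le> ((?n - 4) * ?N + 4 * (norm (avg I f))\<^sup>2) + ((?n - 4) * ?N + 4 * (norm (avg I g))\<^sup>2)"
    using even_spectral_gap[OF I, of f] even_spectral_gap[OF I, of g] even nf by (intro add_mono) auto
  \<comment> \<open>n cancels: 2(n - 2)N <= 2(n - 4)N + 4(|Ef|^2 + |Eg|^2) leaves 4N on the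
    left.\<close>
  finally have "?N \<le> (norm (avg I f))\<^sup>2 + (norm (avg I g))\<^sup>2" by (simp add: algebra_simps)
  then show ?thesis by (simp add: f_def g_def)
qed

lemma avg_rsum_square:
  fixes C D :: "'i \<Rightarrow> cmat"
  assumes I: "finite I"
  shows "avg I (\<lambda>x. adj (rsum I C x) * rsum I D x) = (\<Sum>k\<in>I. adj (C k) * D k)"
proof -
  have "avg I (\<lambda>x. adj (rsum I C x) * rsum I D x) =
        avg I (\<lambda>x. \<Sum>k\<in>I. \<Sum>l\<in>I. (eps x k * eps x l) *\<^sub>R (adj (C k) * D l))"
    by (simp add: rsum_def adj_sum adj_scaleR sum_product mult.commute)
  also have "\<dots> = (\<Sum>k\<in>I. \<Sum>l\<in>I. avg I (\<lambda>x. eps x k * eps x l) *\<^sub>R (adj (C k) * D l))"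
    unfolding avg_sum avg_scaleR_left ..
  also have "\<dots> = (\<Sum>k\<in>I. \<Sum>l\<in>I. if k = l then adj (C k) * D k else 0)"
    using I by (intro sum.cong refl) (simp add: avg_eps)
  also have "\<dots> = (\<Sum>k\<in>I. adj (C k) * D k)" using I by simp
  finally show ?thesis .
qed

lemma linear_rtr: "linear rtr"
  by (rule linearI) (simp_all add: rtr_add rtr_scaleR)

lemma avg_rsum_norm:
  assumes I: "finite I"
  shows "avg I (\<lambda>x. (norm (rsum I C x))\<^sup>2) = (\<Sum>k\<in>I. (norm (C k :: cmat))\<^sup>2)"
  using arg_cong[OF avg_rsum_square[OF I, of C C], of rtr]
  by (simp add: avg_linear[OF linear_rtr] rtr_sum norm_sq_rtr)

lemma avg_eps_rsum:
  fixes C :: "'i \<Rightarrow> 'a::real_vector"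
  assumes I: "finite I" and k: "k \<in> I"
  shows "avg I (\<lambda>x. eps x k *\<^sub>R rsum I C x) = C k"
proof -
  have "avg I (\<lambda>x. eps x k *\<^sub>R rsum I C x) = avg I (\<lambda>x. \<Sum>l\<in>I. (eps x k * eps x l) *\<^sub>R C l)"
    by (simp add: rsum_def scaleR_sum_right)
  also have "\<dots> = (\<Sum>l\<in>I. avg I (\<lambda>x. eps x k * eps x l) *\<^sub>R C l)"
    unfolding avg_sum avg_scaleR_left ..
  also have "\<dots> = (\<Sum>l\<in>I. if k = l then C k else 0)"
    using I k by (intro sum.cong refl) (simp add: avg_eps)
  finally show ?thesis using I k by simp
qed

subsection \<open>The dual form of the inequality\<close>

definition rad_tnorm :: "'i set \<Rightarrow> ('i \<Rightarrow> cmat) \<Rightarrow> real" where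
  "rad_tnorm I C = avg I (\<lambda>x. tnorm (rsum I C x))"

lemma rsum_mats [simp]: "(\<And>k. k \<in> I \<Longrightarrow> C k \<in> mats d) \<Longrightarrow> rsum I C x \<in> mats d"
  by (simp add: rsum_def)

lemma rsum_cong: "(\<And>k. k \<in> I \<Longrightarrow> C k = D k) \<Longrightarrow> rsum I C x = rsum I D x"
  by (simp add: rsum_def)

lemma rad_tnorm_cong: "(\<And>k. k \<in> I \<Longrightarrow> C k = D k) \<Longrightarrow> rad_tnorm I C = rad_tnorm I D"
  unfolding rad_tnorm_def using rsum_cong[of I C D] by (simp cong: avg_cong)

lemma rad_tnorm_scaleR: "rad_tnorm I (\<lambda>k. r *\<^sub>R C k) = \<bar>r\<bar> * rad_tnorm I C"
proof -
  have "rsum I (\<lambda>k. r *\<^sub>R C k) x = r *\<^sub>R rsum I C x" for x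
    by (simp add: rsum_def scaleR_sum_right mult.commute)
  then show ?thesis by (simp add: rad_tnorm_def tnorm_scaleR avg_mult)
qed

lemma rad_tnorm_nonneg: "0 \<le> rad_tnorm I C"
  by (simp add: rad_tnorm_def avg_nonneg)

text \<open>C k is the mean of its sign times S, and the Frobenius norm is below the trace norm.
  Hence \<open>rad_tnorm\<close> is positive on nonzero families and may serve as a
  denominator.\<close>

lemma norm_le_rad_tnorm:
  assumes "finite I" "k \<in> I"
  shows "norm (C k) \<le> rad_tnorm I C"
proof -
  have "norm (C k) = norm (avg I (\<lambda>x. eps x k *\<^sub>R rsum I C x))"
    by (simp add: avg_eps_rsum[OF assms])
  also have "\<dots> \<le> avg I (\<lambda>x. norm (eps x k *\<^sub>R rsum I C x))"
    using norm_sum[of "\<lambda>x. eps x k *\<^sub>R rsum I C x" "Pow I"] by (simp add: avg_def divide_right_mono)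
  also have "\<dots> \<le> rad_tnorm I C"
    unfolding rad_tnorm_def
  proof (rule avg_mono)
    fix x
    have "\<bar>eps x k\<bar> = 1" using eps_cases[of x k] by auto
    then show "norm (eps x k *\<^sub>R rsum I C x) \<le> tnorm (rsum I C x)" by (simp add: norm_le_tnorm)
  qed
  finally show ?thesis .
qed

text \<open>Conjugating the positive block of S by W and V keeps it positive, so the absolute value
  of the transformed matrix never has to be computed.\<close>

lemma tnorm_congruence_le:
  assumes "S \<in> mats d" "V \<in> mats d" "W \<in> mats d"
  shows "2 * tnorm (adj V * S * W) \<le> rtr (adj W * absm S * W) + rtr (adj V * absm (adj S) * V)"
proof (rule tnorm_le_block[where d = d])
  fix Z X
  show "2 * inner Z (adj V * S * W * X) \<le> inner X (adj W * absm S * W * X) + inner Z (adj V * absm (adj S) * V * Z)"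
    using absm_block[of "V * Z" S "W * X"] by (simp add: inner_mult_left mult.assoc)
qed (use assms in \<open>auto intro!: pos_congruence pos_absm\<close>)

text \<open>After averaging, only the means of |S| and |S*| remain; this is where a and b of the
  extremal argument come from.\<close>

lemma rad_tnorm_congruence_le:
  assumes C: "\<And>k. k \<in> I \<Longrightarrow> C k \<in> mats d" and VW: "V \<in> mats d" "W \<in> mats d"
  shows "2 * rad_tnorm I (\<lambda>k. adj V * C k * W) \<le>
         rtr (adj W * avg I (\<lambda>x. absm (rsum I C x)) * W) +
         rtr (adj V * avg I (\<lambda>x. absm (adj (rsum I C x))) * V)"
proof -
  have rs: "rsum I (\<lambda>k. adj V * C k * W) x = adj V * rsum I C x * W" for x
    by (simp add: rsum_def sum_distrib_left sum_distrib_right)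
  have lin: "linear (\<lambda>A. rtr (adj U * A * U))" for U
    by (rule linearI) (simp_all add: distrib_left distrib_right rtr_add rtr_scaleR)
  have "2 * rad_tnorm I (\<lambda>k. adj V * C k * W) = avg I (\<lambda>x. 2 * tnorm (adj V * rsum I C x * W))"
    by (simp add: rad_tnorm_def rs avg_mult)
  also have "\<dots> \<le> avg I (\<lambda>x. rtr (adj W * absm (rsum I C x) * W) + rtr (adj V * absm (adj (rsum I C x)) * V))"
    using C VW by (intro avg_mono tnorm_congruence_le[where d = d]) auto
  also have "\<dots> = rtr (adj W * avg I (\<lambda>x. absm (rsum I C x)) * W) +
                   rtr (adj V * avg I (\<lambda>x. absm (adj (rsum I C x))) * V)"
    unfolding avg_add avg_linear[OF lin] ..
  finally show ?thesis .
qed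

text \<open>Fixing the value 0 outside I makes the set compact in the product topology for every
  index type.\<close>

definition families :: "nat \<Rightarrow> 'i set \<Rightarrow> real \<Rightarrow> ('i \<Rightarrow> cmat) set" where
  "families d I r = PiE UNIV (\<lambda>k. if k \<in> I then {A \<in> mats d. norm A \<le> r} else {0})"

lemma compact_families: "compact (families d I r)"
  unfolding families_def by (rule compact_PiE_UNIV) (simp add: compact_mats_cball)

lemma families_iff: "C \<in> families d I r \<longleftrightarrow> (\<forall>k. if k \<in> I then C k \<in> mats d \<and> norm (C k) \<le> r else C k = 0)"
  by (auto simp: families_def PiE_UNIV_domain Pi_iff split: if_splits)

lemma continuous_on_coordinate: "continuous_on S (\<lambda>C::'i \<Rightarrow> cmat. C k)"
  by (rule continuous_on_subset[OF continuous_on_product_coordinates subset_UNIV])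

lemma continuous_on_rad_tnorm:
  assumes "finite I"
  shows "continuous_on (families d I r) (rad_tnorm I)"
proof -
  have "continuous_on (families d I r) (\<lambda>C. tnorm (rsum I C x))" for x
  proof (rule continuous_on_compose2[OF continuous_on_tnorm])
    show "continuous_on (families d I r) (\<lambda>C. rsum I C x)"
      unfolding rsum_def by (intro continuous_intros continuous_on_coordinate)
    show "(\<lambda>C. rsum I C x) ` families d I r \<subseteq> mats d"
      by (auto simp: families_iff split: if_splits)
  qed
  then show ?thesis
    unfolding rad_tnorm_def avg_def by (intro continuous_intros)
qed

text \<open>The extremal \<open>C\<close> for a given \<open>D\<close> is stationary along \<open>C \<mapsto> (1 + tb) C (1 + ta)\<close>, where \<open>a\<close> and \<open>b\<close> are the means of
  \<open>|S|\<close> and \<open>|S*|\<close>; to first order this moves the trace norm by the right-hand side of the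
  Latala--Oleszkiewicz inequality.\<close>

theorem dual_khintchine:
  fixes C D :: "'i \<Rightarrow> cmat"
  assumes I: "finite I"
    and col: "\<And>W. (\<Sum>k\<in>I. (norm (D k * W))\<^sup>2) \<le> (norm W)\<^sup>2"
    and row: "\<And>W. (\<Sum>k\<in>I. (norm (W * D k))\<^sup>2) \<le> (norm W)\<^sup>2"
    and C: "\<And>k. k \<in> I \<Longrightarrow> C k \<in> mats d"
  shows "(\<Sum>k\<in>I. inner (D k) (C k)) \<le> sqrt 2 * rad_tnorm I C"
proof -
  let ?N = "rad_tnorm I" and ?l = "\<lambda>C. \<Sum>k\<in>I. inner (D k) (C k)" and ?q = "\<lambda>C. \<Sum>k\<in>I. (norm (C k :: cmat))\<^sup>2"
  \<comment> \<open>The quotient to be maximized is homogeneous, so a compact unit sphere suffices;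
    \<open>le\<close> below extends the bound to all families.\<close>
  let ?K = "families d I 1 \<inter> {C. ?q C = 1}"
  have normalize: "(\<lambda>k. if k \<in> I then (1 / sqrt (?q B)) *\<^sub>R B k else 0) \<in> ?K"
    if B: "\<And>k. k \<in> I \<Longrightarrow> B k \<in> mats d" and q: "?q B \<noteq> 0" for B
  proof -
    have q0: "0 \<le> ?q B" by (rule sum_nonneg) simp
    have "norm (B k) \<le> sqrt (?q B)" if "k \<in> I" for k
      using I that by (intro real_le_rsqrt member_le_sum) auto
    then have "norm (B k) / sqrt (?q B) \<le> 1" if "k \<in> I" for k
      using that q q0 by (simp add: divide_le_eq)
    moreover have "(\<Sum>k\<in>I. (norm (if k \<in> I then (1 / sqrt (?q B)) *\<^sub>R B k else 0))\<^sup>2) = ?q B / ?q B"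
      using q0 by (simp add: power_divide sum_divide_distrib[symmetric])
    ultimately show ?thesis using B q q0 by (simp add: families_iff)
  qed
  show ?thesis
  proof (cases "?q C = 0")
    case True
    then have "\<And>k. k \<in> I \<Longrightarrow> C k = 0" using I by (simp add: sum_nonneg_eq_0_iff)
    then show ?thesis using rad_tnorm_nonneg[of I C] by simp
  next
    case False
    have "closed {C. ?q C = 1}"
      by (intro closed_Collect_eq continuous_intros continuous_on_coordinate)
    then have K: "compact ?K" by (intro compact_Int_closed compact_families)
    have Npos: "0 < ?N B" if "B \<in> ?K" for B
    proof (rule ccontr)
      assume "\<not> 0 < ?N B"
      then have "?N B = 0" using rad_tnorm_nonneg[of I B] by linarith
      then have "B k = 0" if "k \<in> I" for k using norm_le_rad_tnorm[OF I that, of B] by simp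
      then show False using that by simp
    qed
    have "continuous_on ?K (\<lambda>C. ?l C / ?N C)"
    proof (rule continuous_on_divide)
      show "continuous_on ?K ?l" by (intro continuous_intros continuous_on_coordinate)
      show "continuous_on ?K ?N" by (rule continuous_on_subset[OF continuous_on_rad_tnorm[OF I] Int_lower1])
      show "\<forall>C\<in>?K. ?N C \<noteq> 0" using Npos by fastforce
    qed
    moreover have "?K \<noteq> {}" using normalize[OF C False] by blast
    ultimately obtain M where M: "M \<in> ?K" and max: "\<And>B. B \<in> ?K \<Longrightarrow> ?l B / ?N B \<le> ?l M / ?N M"
      using continuous_attains_sup[OF K] by blast
    define A where "A = ?l M / ?N M"
    have le: "?l B \<le> A * ?N B" if B: "\<And>k. k \<in> I \<Longrightarrow> B k \<in> mats d" for B
    proof (cases "?q B = 0")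
      case True
      then have B0: "\<And>k. k \<in> I \<Longrightarrow> B k = 0" using I by (simp add: sum_nonneg_eq_0_iff)
      then have "rsum I B x = 0" for x by (simp add: rsum_def)
      then have "?N B = 0" by (simp add: rad_tnorm_def avg_const[OF I])
      with B0 show ?thesis by simp
    next
      case False
      let ?s = "1 / sqrt (?q B)"
      have q0: "0 \<le> ?q B" by (rule sum_nonneg) simp
      then have s: "0 < ?s" using False by simp
      let ?B = "\<lambda>k. if k \<in> I then ?s *\<^sub>R B k else 0"
      have BK: "?B \<in> ?K" by (rule normalize[OF B False])
      have "?N ?B = ?N (\<lambda>k. ?s *\<^sub>R B k)" by (rule rad_tnorm_cong) simp
      then have NB: "?N ?B = ?s * ?N B" using s by (simp add: rad_tnorm_scaleR)
      have "?l ?B = ?s * ?l B" by (simp add: sum_divide_distrib)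
      moreover have "?l ?B \<le> A * ?N ?B"
        using max[OF BK] Npos[OF BK] unfolding A_def[symmetric] by (simp only: pos_divide_le_eq)
      ultimately have "?s * ?l B \<le> ?s * (A * ?N B)" by (simp only: NB mult.left_commute)
      then show ?thesis using s by (simp only: mult_le_cancel_left_pos)
    qed
    have MI: "M k \<in> mats d" if "k \<in> I" for k using M that by (auto simp: families_iff split: if_splits)
    have lM: "?l M = A * ?N M" using Npos[OF M] by (simp add: A_def)
    define a where "a = avg I (\<lambda>x. absm (rsum I M x))"
    define b where "b = avg I (\<lambda>x. absm (adj (rsum I M x)))"
    define q where "q = (norm a)\<^sup>2 + (norm b)\<^sup>2"
    have ab: "a \<in> mats d" "b \<in> mats d" using MI by (auto simp: a_def b_def avg_def)
    have adj_ab: "adj a = a" "adj b = b" by (simp_all add: a_def b_def avg_def adj_scaleR adj_sum)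
    have tr_ab: "rtr a = ?N M" "rtr b = ?N M"
      by (simp_all add: a_def b_def avg_linear[OF linear_rtr] tnorm_def[symmetric] rad_tnorm_def)
    have "?q M \<le> q"
      using latala_oleszkiewicz[OF I, of M] by (simp add: avg_rsum_norm[OF I] q_def a_def b_def)
    \<comment> \<open>The normalization \<open>?q M = 1\<close> keeps q away from 0, so that it can
      be cancelled at the end.\<close>
    then have q1: "1 \<le> q" and qM: "?q M \<le> q" using M by auto
    let ?L = "\<Sum>k\<in>I. inner (D k) (b * M k + M k * a)"
    let ?r = "(rtr (a * a * a) + rtr (b * b * b)) / 2"
    let ?m = "\<Sum>k\<in>I. inner (D k) (b * M k * a)"
    have "A \<le> sqrt 2"
    \<comment> \<open>The upper bound for \<open>?N ?B\<close> is multiplied by A below, which needs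
      A >= 0; for A < 0 the claim is trivial.\<close>
    proof (cases "A < 0")
      case False
      have "0 \<le> t * (A * q - ?L) + t\<^sup>2 * (A * ?r - ?m)" for t
      proof -
        let ?V = "idm d + t *\<^sub>R b" and ?W = "idm d + t *\<^sub>R a"
        let ?B = "\<lambda>k. adj ?V * M k * ?W"
        have VW: "?V \<in> mats d" "?W \<in> mats d" "adj ?V = ?V" "adj ?W = ?W"
          using ab adj_ab by (simp_all add: adj_add adj_scaleR)
        have sq: "rtr ((idm d + t *\<^sub>R c) * c * (idm d + t *\<^sub>R c)) = rtr c + 2 * t * (norm c)\<^sup>2 + t\<^sup>2 * rtr (c * c * c)"
          if "c \<in> mats d" "adj c = c" for c
        proof -
          have "(norm c)\<^sup>2 = rtr (c * c)" using that by (simp add: norm_sq_rtr)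
          then show ?thesis
            using that by (simp add: distrib_left distrib_right rtr_add rtr_scaleR) (simp add: power2_eq_square)
        qed
        have "2 * ?N ?B \<le> rtr (?W * a * ?W) + rtr (?V * b * ?V)"
          using rad_tnorm_congruence_le[of I M d ?V ?W] MI VW by (simp add: a_def b_def)
        also have "\<dots> = 2 * (?N M + t * q + t\<^sup>2 * ?r)"
          unfolding sq[OF ab(1) adj_ab(1)] sq[OF ab(2) adj_ab(2)] tr_ab q_def by (simp add: algebra_simps)
        finally have NB: "?N ?B \<le> ?N M + t * q + t\<^sup>2 * ?r" by (rule mult_left_le_imp_le) simp
        have "?B k = M k + t *\<^sub>R (b * M k + M k * a) + t\<^sup>2 *\<^sub>R (b * M k * a)" if "k \<in> I" for k
          using MI[OF that] ab VW(3) by (simp add: distrib_left distrib_right scaleR_right_distrib power2_eq_square)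
        then have "?l ?B = (\<Sum>k\<in>I. inner (D k) (M k) + t * inner (D k) (b * M k + M k * a) + t\<^sup>2 * inner (D k) (b * M k * a))"
          by (intro sum.cong refl) (simp add: inner_add_right)
        also have "\<dots> = ?l M + t * ?L + t\<^sup>2 * ?m"
          by (simp only: sum.distrib sum_distrib_left)
        finally have "?l M + t * ?L + t\<^sup>2 * ?m = ?l ?B" ..
        also have "\<dots> \<le> A * ?N ?B" using MI VW by (intro le) simp
        also have "\<dots> \<le> A * (?N M + t * q + t\<^sup>2 * ?r)" using NB False by (intro mult_left_mono) auto
        finally show ?thesis using lM by (simp add: algebra_simps)
      qed
      from linear_coefficient_zero[OF this] have "A * q = ?L" by simp
      also have "?L = (\<Sum>k\<in>I. inner (b * D k + D k * a) (M k))"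
        using inner_mult_left[of b] inner_mult_right[of _ a]
        by (simp add: inner_add_left inner_add_right adj_ab)
      also have "\<dots> \<le> (\<Sum>k\<in>I. (1 / sqrt 2) * ((norm (b * D k))\<^sup>2 + (norm (D k * a))\<^sup>2) + (1 / sqrt 2) * (norm (M k))\<^sup>2)"
      proof (rule sum_mono)
        fix k
        let ?u = "b * D k" and ?v = "D k * a" and ?w = "M k"
        \<comment> \<open>The weight sqrt 2 is balanced: the sums over k of |u|^2 + |v|^2 and of
          |w|^2 are both at most q.\<close>
        have "0 \<le> inner (?u + ?v - sqrt 2 *\<^sub>R ?w) (?u + ?v - sqrt 2 *\<^sub>R ?w) + inner (?u - ?v) (?u - ?v)"
          by (intro add_nonneg_nonneg inner_ge_zero)
        also have "\<dots> = 2 * (norm ?u)\<^sup>2 + 2 * (norm ?v)\<^sup>2 + 2 * (norm ?w)\<^sup>2 - 2 * sqrt 2 * inner (?u + ?v) ?w"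
          by (simp add: power2_norm_eq_inner inner_add_left inner_add_right inner_diff_left inner_diff_right inner_commute algebra_simps)
        finally have "sqrt 2 * inner (?u + ?v) ?w \<le> (norm ?u)\<^sup>2 + (norm ?v)\<^sup>2 + (norm ?w)\<^sup>2" by simp
        then have "inner (?u + ?v) ?w \<le> ((norm ?u)\<^sup>2 + (norm ?v)\<^sup>2 + (norm ?w)\<^sup>2) / sqrt 2"
          by (simp add: pos_le_divide_eq mult.commute)
        then show "inner (?u + ?v) ?w \<le> (1 / sqrt 2) * ((norm ?u)\<^sup>2 + (norm ?v)\<^sup>2) + (1 / sqrt 2) * (norm ?w)\<^sup>2"
          by (simp add: add_divide_distrib)
      qed
      also have "\<dots> = (1 / sqrt 2) * ((\<Sum>k\<in>I. (norm (b * D k))\<^sup>2) + (\<Sum>k\<in>I. (norm (D k * a))\<^sup>2)) + (1 / sqrt 2) * ?q M"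
        by (simp only: sum.distrib sum_distrib_left[symmetric])
      also have "\<dots> \<le> (1 / sqrt 2) * q + (1 / sqrt 2) * q"
        using col[of a] row[of b] qM by (intro add_mono mult_left_mono) (auto simp: q_def)
      also have "\<dots> = sqrt 2 * q" by (simp add: field_simps)
      finally show ?thesis using q1 by simp
    qed (use real_sqrt_ge_zero[of 2] in linarith)
    then show ?thesis
      using le[OF C] rad_tnorm_nonneg[of I C] by (meson mult_right_mono order_trans)
  qed
qed

subsection \<open>Column norms and duality\<close>

definition colnorm :: "'i set \<Rightarrow> ('i \<Rightarrow> cmat) \<Rightarrow> real" where
  "colnorm I X = rtr (csqrt_mat (\<Sum>k\<in>I. adj (X k) * X k))"

definition reg_sqrt_trace :: "nat \<Rightarrow> real \<Rightarrow> cmat \<Rightarrow> real" where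
  "reg_sqrt_trace d e T = rtr (csqrt_mat (T + e\<^sup>2 *\<^sub>R idm d))"

definition reg_colnorm :: "nat \<Rightarrow> real \<Rightarrow> 'i set \<Rightarrow> ('i \<Rightarrow> cmat) \<Rightarrow> real" where
  "reg_colnorm d e I X = reg_sqrt_trace d e (\<Sum>k\<in>I. adj (X k) * X k)"

lemma pos_column_square: "pos (\<Sum>k\<in>I. adj (X k) * X k)"
  by (intro pos_sum pos_adj_mult)

lemma rtr_column_square: "rtr (\<Sum>k\<in>I. adj (X k) * X k) = (\<Sum>k\<in>I. (norm (X k))\<^sup>2)"
  by (simp add: rtr_sum norm_sq_rtr)

lemma colnorm_nonneg: "0 \<le> colnorm I X"
  by (simp add: colnorm_def rtr_nonneg pos_csqrt_mat pos_column_square)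

text \<open>The left side is the Frobenius norm of the square root whose trace is
  \<open>colnorm\<close>. This gives coercivity in the minimization and the lower bound in the
  sharpness example.\<close>

lemma L2_set_le_colnorm: "L2_set (\<lambda>k. norm (X k)) I \<le> colnorm I X"
proof -
  let ?T = "\<Sum>k\<in>I. adj (X k) * X k"
  let ?s = "csqrt_mat ?T"
  have s: "pos ?s" "adj ?s = ?s" "?s * ?s = ?T"
    using pos_column_square[of X I] by (auto simp: pos_csqrt_mat csqrt_mat_square posD(1))
  have "(norm ?s)\<^sup>2 = (\<Sum>k\<in>I. (norm (X k))\<^sup>2)"
    by (simp only: norm_sq_rtr s rtr_column_square)
  then have "L2_set (\<lambda>k. norm (X k)) I = norm ?s"
    by (simp add: L2_set_def real_sqrt_unique)
  with norm_le_rtr[OF s(1)] show ?thesis by (simp add: colnorm_def)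
qed

lemma norm_idm_mult: "norm (idm d * W) \<le> norm W"
proof -
  have "(norm (idm d * W))\<^sup>2 = inner W (idm d * W)"
    by (simp add: power2_norm_eq_inner inner_mult_left mult.assoc[symmetric])
  also have "\<dots> \<le> norm W * norm (idm d * W)" by (rule norm_cauchy_schwarz)
  finally show ?thesis
    by (cases "idm d * W = 0") (auto simp: power2_eq_square mult_le_cancel_right)
qed

text \<open>The matrix (T + e^2)^(-1/2). Inverses exist only relative to \<open>idm d\<close>, hence
  the choice; the trace bound is carried along in the specification.\<close>

definition reg_inv_sqrt :: "nat \<Rightarrow> real \<Rightarrow> cmat \<Rightarrow> cmat" where
  "reg_inv_sqrt d e T = (SOME c. c \<in> mats d \<and> pos c \<and>
     csqrt_mat (T + e\<^sup>2 *\<^sub>R idm d) * c = idm d \<and> c * csqrt_mat (T + e\<^sup>2 *\<^sub>R idm d) = idm d \<and> rtr c \<le> d / e)"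

context
  fixes T :: cmat and d :: nat and e :: real
  assumes T: "T \<in> mats d" "pos T" and e: "0 < e"
begin

private definition "g = csqrt_mat (T + e\<^sup>2 *\<^sub>R idm d)"
private definition "c = reg_inv_sqrt d e T"

private lemma g: "g \<in> mats d" "pos g" "g * g = T + e\<^sup>2 *\<^sub>R idm d"
proof -
  have "T + e\<^sup>2 *\<^sub>R idm d \<in> mats d" "pos (T + e\<^sup>2 *\<^sub>R idm d)"
    using T by (auto intro!: pos_add pos_scaleR)
  then show "g \<in> mats d" "pos g" "g * g = T + e\<^sup>2 *\<^sub>R idm d"
    by (auto simp: g_def csqrt_mat)
qed

private lemma c: "c \<in> mats d" "pos c" "g * c = idm d" "c * g = idm d" "rtr c \<le> d / e"
proof -
  obtain c' where "c' \<in> mats d" "pos c'" "g * c' = idm d" "c' * g = idm d" "rtr c' \<le> d / e"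
    using regularized_sqrt[OF T e] unfolding g_def by blast
  then have "\<exists>c. c \<in> mats d \<and> pos c \<and> g * c = idm d \<and> c * g = idm d \<and> rtr c \<le> d / e" by blast
  from someI_ex[OF this] show "c \<in> mats d" "pos c" "g * c = idm d" "c * g = idm d" "rtr c \<le> d / e"
    unfolding c_def reg_inv_sqrt_def g_def by blast+
qed

lemma reg_sqrt_trace_ge: "rtr (csqrt_mat T) \<le> reg_sqrt_trace d e T"
  and reg_sqrt_trace_le: "reg_sqrt_trace d e T \<le> rtr (csqrt_mat T) + e * d"
  unfolding reg_sqrt_trace_def by (rule regularized_sqrt[OF T e]; assumption)+

lemma reg_inv_sqrt_mats: "reg_inv_sqrt d e T \<in> mats d"
  using c(1) by (simp add: c_def)

lemma adj_reg_inv_sqrt: "adj (reg_inv_sqrt d e T) = reg_inv_sqrt d e T"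
  using posD(1)[OF c(2)] by (simp add: c_def)

lemma rtr_reg_inv_sqrt_nonneg: "0 \<le> rtr (reg_inv_sqrt d e T)"
  using rtr_nonneg[OF c(2)] by (simp add: c_def)

lemma rtr_reg_inv_sqrt_le: "rtr (reg_inv_sqrt d e T) \<le> d / e"
  using c(5) by (simp add: c_def)

lemma norm_reg_inv_sqrt_le: "norm (reg_inv_sqrt d e T) \<le> d / e"
  using norm_le_rtr[OF c(2)] c(5) by (simp add: c_def)

private lemma cgg: "c * (g * g) = g"
  using c(4) g(1) by (simp add: mult.assoc[symmetric])

private lemma T_eq: "T = g * g - e\<^sup>2 *\<^sub>R idm d"
  by (simp add: g(3))

lemma rtr_reg_inv_sqrt_mult:
  "rtr (reg_inv_sqrt d e T * T) = reg_sqrt_trace d e T - e\<^sup>2 * rtr (reg_inv_sqrt d e T)"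
proof -
  have "c * T = c * (g * g) - e\<^sup>2 *\<^sub>R c"
    using c(1) by (subst T_eq) (simp add: right_diff_distrib)
  then have "rtr (c * T) = rtr g - e\<^sup>2 * rtr c"
    unfolding cgg by (simp add: rtr_diff rtr_scaleR)
  then show ?thesis by (simp add: c_def g_def reg_sqrt_trace_def)
qed

text \<open>With c the inverse of g and g^2 = T + e^2, c T c = 1 - e^2 c^2 <= 1 on the first d
  coordinates.\<close>

lemma inner_reg_inv_sqrt_le:
  "inner (reg_inv_sqrt d e T * W) (T * (reg_inv_sqrt d e T * W)) \<le> (norm W)\<^sup>2"
proof -
  have "inner (c * W) (T * (c * W)) = inner (c * W) (g * (g * (c * W))) - e\<^sup>2 * inner (c * W) (idm d * (c * W))"
    by (subst T_eq) (simp add: left_diff_distrib inner_diff_right mult.assoc)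
  also have "inner (c * W) (g * (g * (c * W))) = (norm (g * (c * W)))\<^sup>2"
    by (simp only: power2_norm_eq_inner inner_mult_left[of g] posD(1)[OF g(2)])
  also have "idm d * (c * W) = c * W" using c(1) by (simp add: mult.assoc[symmetric])
  also have "(norm (g * (c * W)))\<^sup>2 - e\<^sup>2 * inner (c * W) (c * W) \<le> (norm (g * (c * W)))\<^sup>2" by simp
  also have "g * (c * W) = idm d * W" using c(3) by (simp add: mult.assoc[symmetric])
  also have "(norm (idm d * W))\<^sup>2 \<le> (norm W)\<^sup>2" by (intro power_mono norm_idm_mult) simp
  finally show ?thesis by (simp add: c_def)
qed

text \<open>The tangent inequality of the concave function R -> tr R^(1/2) at T + e^2, taken at R =
  f^2; its derivative there is half of \<open>reg_inv_sqrt d e T\<close>.\<close>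

lemma reg_sqrt_trace_variational:
  assumes f: "f \<in> mats d" "pos f"
  shows "2 * rtr f \<le> rtr (reg_inv_sqrt d e T * (f * f - (T + e\<^sup>2 *\<^sub>R idm d))) + 2 * reg_sqrt_trace d e T"
proof -
  have "2 * rtr f \<le> rtr (c * (f * f)) + rtr g"
    by (rule rtr_variational[OF f(2) g(2) c(2) c(3) f(1) g(1)])
  also have "\<dots> = rtr (c * (f * f - g * g)) + 2 * rtr g"
    unfolding right_diff_distrib rtr_diff cgg by simp
  finally show ?thesis unfolding g(3) by (simp add: c_def g_def reg_sqrt_trace_def)
qed

end

text \<open>The tangent inequality at either point has slope at most d / (2 e); the factor 1/2 is
  given away.\<close>

lemma lipschitz_reg_sqrt_trace:
  assumes e: "0 < e"
  shows "(d / e)-lipschitz_on {T \<in> mats d. pos T} (reg_sqrt_trace d e)"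
proof (rule lipschitz_onI)
  have *: "reg_sqrt_trace d e R - reg_sqrt_trace d e T \<le> d / e * norm (R - T)"
    if T: "T \<in> mats d" "pos T" and R: "R \<in> mats d" "pos R" for R T
  proof -
    let ?c = "reg_inv_sqrt d e T"
    have Re: "R + e\<^sup>2 *\<^sub>R idm d \<in> mats d" "pos (R + e\<^sup>2 *\<^sub>R idm d)"
      using R by (auto intro!: pos_add pos_scaleR)
    have "2 * reg_sqrt_trace d e R \<le> rtr (?c * (R - T)) + 2 * reg_sqrt_trace d e T"
      using reg_sqrt_trace_variational[OF T e csqrt_mat_mats[OF Re(2,1)] pos_csqrt_mat[OF Re(2)]]
      unfolding csqrt_mat_square[OF Re(2)] reg_sqrt_trace_def by simp
    also have "rtr (?c * (R - T)) = inner ?c (R - T)" by (simp add: inner_cmat_def adj_reg_inv_sqrt[OF T e])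
    also have "\<dots> \<le> norm ?c * norm (R - T)" by (rule norm_cauchy_schwarz)
    also have "\<dots> \<le> d / e * norm (R - T)" by (intro mult_right_mono norm_reg_inv_sqrt_le T e) simp
    finally have "2 * reg_sqrt_trace d e R \<le> d / e * norm (R - T) + 2 * reg_sqrt_trace d e T" by simp
    moreover have "0 \<le> d / e * norm (R - T)" using e by simp
    moreover have "x - y \<le> z" if "2 * x \<le> z + 2 * y" "0 \<le> z" for x y z :: real using that by simp
    ultimately show ?thesis by blast
  qed
  fix R T assume "R \<in> {T \<in> mats d. pos T}" "T \<in> {T \<in> mats d. pos T}"
  then show "dist (reg_sqrt_trace d e R) (reg_sqrt_trace d e T) \<le> d / e * dist R T"
    using *[of R T] *[of T R] by (simp add: dist_norm abs_le_iff norm_minus_commute)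
qed (use e in simp)

lemma bounded_linear_adj: "bounded_linear adj"
  by (rule bounded_linear_intro[where K = 1]) (simp_all add: adj_add adj_scaleR)

lemma continuous_on_reg_colnorm:
  assumes e: "0 < e" and F: "\<And>k. k \<in> I \<Longrightarrow> continuous_on S (\<lambda>C. F C k)"
    and mats: "\<And>C k. C \<in> S \<Longrightarrow> k \<in> I \<Longrightarrow> F C k \<in> mats d"
  shows "continuous_on S (\<lambda>C. reg_colnorm d e I (F C))"
  unfolding reg_colnorm_def
proof (rule continuous_on_compose2[OF lipschitz_on_continuous_on[OF lipschitz_reg_sqrt_trace[OF e]]])
  show "continuous_on S (\<lambda>C. \<Sum>k\<in>I. adj (F C k) * F C k)"
    by (intro continuous_on_sum continuous_on_mult bounded_linear.continuous_on[OF bounded_linear_adj] F)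
  show "(\<lambda>C. \<Sum>k\<in>I. adj (F C k) * F C k) ` S \<subseteq> {T \<in> mats d. pos T}"
    using mats by (auto intro!: pos_column_square)
qed

text \<open>\<open>X k * colgrad d e I X\<close> is the gradient of \<open>reg_colnorm d e I\<close> at \<open>X\<close>.\<close>

definition colgrad :: "nat \<Rightarrow> real \<Rightarrow> 'i set \<Rightarrow> ('i \<Rightarrow> cmat) \<Rightarrow> cmat" where
  "colgrad d e I X = reg_inv_sqrt d e (\<Sum>k\<in>I. adj (X k) * X k)"

context
  fixes X :: "'i \<Rightarrow> cmat" and I :: "'i set" and d :: nat and e :: real
  assumes X: "\<And>k. k \<in> I \<Longrightarrow> X k \<in> mats d" and e: "0 < e"
begin

private abbreviation (input) "TX \<equiv> \<Sum>k\<in>I. adj (X k) * X k"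
private abbreviation (input) "cX \<equiv> colgrad d e I X"

private lemma TX: "TX \<in> mats d" "pos TX"
  using X by (auto intro: pos_column_square)

lemma colgrad_mats: "cX \<in> mats d"
  unfolding colgrad_def by (rule reg_inv_sqrt_mats[OF TX e])

lemma adj_colgrad: "adj cX = cX"
  unfolding colgrad_def by (rule adj_reg_inv_sqrt[OF TX e])

lemma colnorm_le_reg_colnorm: "colnorm I X \<le> reg_colnorm d e I X"
  unfolding colnorm_def reg_colnorm_def by (rule reg_sqrt_trace_ge[OF TX e])

text \<open>The column constraint for the dual family \<open>X k * cX\<close>, from c T c <= 1.
  Applied to adjoints it also supplies the row constraint.\<close>

lemma colgrad_contraction: "(\<Sum>k\<in>I. (norm (X k * cX * W))\<^sup>2) \<le> (norm W)\<^sup>2"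
proof -
  have "(\<Sum>k\<in>I. (norm (X k * cX * W))\<^sup>2) = inner (cX * W) (TX * (cX * W))"
    by (simp add: power2_norm_eq_inner inner_mult_left sum_distrib_right inner_sum_right mult.assoc adj_colgrad)
  then show ?thesis using inner_reg_inv_sqrt_le[OF TX e, of W] by (simp only: colgrad_def)
qed

lemma sum_inner_colgrad: "(\<Sum>k\<in>I. inner (X k * cX) (H k)) = rtr (cX * (\<Sum>k\<in>I. adj (X k) * H k))"
  by (simp add: inner_cmat_def adj_mult adj_colgrad sum_distrib_left rtr_sum mult.assoc)

lemma reg_colnorm_le_sum_inner: "reg_colnorm d e I X - e * d \<le> (\<Sum>k\<in>I. inner (X k * cX) (X k))"
proof -
  \<comment> \<open>The defect is e^2 tr c, and tr c <= d / e turns it into e d.\<close>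
  have "e\<^sup>2 * rtr cX \<le> e\<^sup>2 * (d / e)"
    unfolding colgrad_def by (intro mult_left_mono rtr_reg_inv_sqrt_le TX e) auto
  then have "e\<^sup>2 * rtr cX \<le> e * d" using e by (simp add: power2_eq_square)
  then show ?thesis
    unfolding sum_inner_colgrad unfolding colgrad_def rtr_reg_inv_sqrt_mult[OF TX e] by (simp add: reg_colnorm_def)
qed

text \<open>The column square of X + t H is exactly quadratic in t, and the tangent inequality is
  affine in it. Hence the bound holds for all t without a remainder estimate.\<close>

lemma reg_colnorm_perturb:
  assumes H: "\<And>k. k \<in> I \<Longrightarrow> H k \<in> mats d"
  shows "reg_colnorm d e I (\<lambda>k. X k + t *\<^sub>R H k) \<le>
    reg_colnorm d e I X + t * (\<Sum>k\<in>I. inner (X k * cX) (H k)) + t\<^sup>2 * (rtr (cX * (\<Sum>k\<in>I. adj (H k) * H k)) / 2)"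
proof -
  let ?X = "\<lambda>k. X k + t *\<^sub>R H k"
  let ?R = "\<Sum>k\<in>I. adj (?X k) * ?X k"
  have Re: "?R + e\<^sup>2 *\<^sub>R idm d \<in> mats d" "pos (?R + e\<^sup>2 *\<^sub>R idm d)"
    using X H by (auto intro!: pos_add pos_scaleR pos_column_square)
  have R: "?R - TX = t *\<^sub>R (\<Sum>k\<in>I. adj (X k) * H k) + t *\<^sub>R adj (\<Sum>k\<in>I. adj (X k) * H k) +
                    t\<^sup>2 *\<^sub>R (\<Sum>k\<in>I. adj (H k) * H k)"
    by (simp add: adj_add adj_scaleR adj_sum adj_mult distrib_left distrib_right sum.distrib
        scaleR_sum_right scaleR_right_distrib power2_eq_square)
  have "rtr (cX * adj (\<Sum>k\<in>I. adj (X k) * H k)) = rtr (adj (cX * adj (\<Sum>k\<in>I. adj (X k) * H k)))"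
    by (simp only: rtr_adj)
  also have "\<dots> = rtr (cX * (\<Sum>k\<in>I. adj (X k) * H k))"
    by (simp only: adj_mult[of cX] adj_adj adj_colgrad rtr_commute[of _ cX])
  finally have sym: "rtr (cX * adj (\<Sum>k\<in>I. adj (X k) * H k)) = (\<Sum>k\<in>I. inner (X k * cX) (H k))"
    by (simp only: sum_inner_colgrad)
  have "2 * reg_colnorm d e I ?X \<le> rtr (cX * (?R - TX)) + 2 * reg_colnorm d e I X"
    using reg_sqrt_trace_variational[OF TX e csqrt_mat_mats[OF Re(2,1)] pos_csqrt_mat[OF Re(2)]]
    unfolding csqrt_mat_square[OF Re(2)] reg_colnorm_def reg_sqrt_trace_def colgrad_def by simp
  also have "rtr (cX * (?R - TX)) = 2 * (t * (\<Sum>k\<in>I. inner (X k * cX) (H k))) + t\<^sup>2 * rtr (cX * (\<Sum>k\<in>I. adj (H k) * H k))"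
    unfolding R unfolding distrib_left rtr_add mult_scaleR_right rtr_scaleR sym by (simp only: sum_inner_colgrad)
  finally show ?thesis by (simp only: mult.commute)
qed

end

section \<open>Lower and upper estimate for finitely supported matrices\<close>

lemma rsum_adj: "rsum I (\<lambda>k. adj (C k)) x = adj (rsum I C x)"
  by (simp add: rsum_def adj_sum adj_scaleR)

lemma rad_tnorm_adj: "rad_tnorm I (\<lambda>k. adj (C k)) = rad_tnorm I C"
  by (simp add: rad_tnorm_def rsum_adj)

text \<open>The tangent inequality at T bounds each tr |S| by an expression affine in
  \<open>adj S * S\<close>, whose mean over the signs is T.\<close>

lemma rad_tnorm_le_colnorm:
  assumes I: "finite I" and X: "\<And>k. k \<in> I \<Longrightarrow> X k \<in> mats d"
  shows "rad_tnorm I X \<le> colnorm I X"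
proof (rule field_le_epsilon)
  fix \<delta> :: real assume "0 < \<delta>"
  define e where "e = \<delta> / (d + 1)"
  have e: "0 < e" using \<open>0 < \<delta>\<close> by (simp add: e_def)
  have ed: "e * d \<le> \<delta>" using \<open>0 < \<delta>\<close> by (simp add: e_def field_simps)
  let ?T = "\<Sum>k\<in>I. adj (X k) * X k"
  have T: "?T \<in> mats d" "pos ?T" using X by (auto intro: pos_column_square)
  define c where "c = reg_inv_sqrt d e ?T"
  note c = reg_inv_sqrt_mats[OF T e, folded c_def] rtr_reg_inv_sqrt_nonneg[OF T e, folded c_def]
  note g = reg_sqrt_trace_le[OF T e] and var = reg_sqrt_trace_variational[OF T e, folded c_def]
  have lin: "linear (\<lambda>A. rtr (c * A))"
    by (rule linearI) (simp_all add: distrib_left rtr_add rtr_scaleR)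
  have "2 * rad_tnorm I X = avg I (\<lambda>x. 2 * rtr (absm (rsum I X x)))"
    by (simp add: rad_tnorm_def tnorm_def avg_mult)
  also have "\<dots> \<le> avg I (\<lambda>x. rtr (c * (adj (rsum I X x) * rsum I X x)) +
      (2 * reg_sqrt_trace d e ?T - rtr (c * (?T + e\<^sup>2 *\<^sub>R idm d))))"
  proof (rule avg_mono)
    fix x
    show "2 * rtr (absm (rsum I X x)) \<le> rtr (c * (adj (rsum I X x) * rsum I X x)) +
      (2 * reg_sqrt_trace d e ?T - rtr (c * (?T + e\<^sup>2 *\<^sub>R idm d)))"
      using var[OF absm_mats[OF rsum_mats[of I X d x]] pos_absm] X
      by (simp add: absm_square right_diff_distrib rtr_diff)
  qed
  also have "\<dots> = rtr (c * ?T) + (2 * reg_sqrt_trace d e ?T - rtr (c * (?T + e\<^sup>2 *\<^sub>R idm d)))"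
    unfolding avg_add avg_linear[OF lin, symmetric] avg_rsum_square[OF I] by (simp add: avg_const[OF I])
  also have "\<dots> = 2 * reg_sqrt_trace d e ?T - e\<^sup>2 * rtr c"
    using c(1) by (simp add: distrib_left rtr_add rtr_scaleR)
  also have "\<dots> \<le> 2 * reg_sqrt_trace d e ?T" using c(2) by simp
  finally show "rad_tnorm I X \<le> colnorm I X + \<delta>"
    using g ed by (simp add: colnorm_def)
qed

theorem rad_tnorm_le_decomposition:
  assumes I: "finite I" and X: "\<And>k. k \<in> I \<Longrightarrow> X k \<in> mats d" and Y: "\<And>k. k \<in> I \<Longrightarrow> Y k \<in> mats d"
    and C: "\<And>k. k \<in> I \<Longrightarrow> C k = X k + Y k"
  shows "rad_tnorm I C \<le> colnorm I X + colnorm I (\<lambda>k. adj (Y k))"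
proof -
  have "rad_tnorm I C \<le> rad_tnorm I X + rad_tnorm I Y"
  proof -
    have "rsum I C x = rsum I X x + rsum I Y x" for x
      using C by (simp add: rsum_def scaleR_right_distrib sum.distrib)
    then show ?thesis
      unfolding rad_tnorm_def avg_add[symmetric] by (intro avg_mono) (simp add: tnorm_triangle)
  qed
  also have "rad_tnorm I X \<le> colnorm I X" using I X by (rule rad_tnorm_le_colnorm)
  also have "rad_tnorm I Y \<le> colnorm I (\<lambda>k. adj (Y k))"
    using rad_tnorm_le_colnorm[of I "\<lambda>k. adj (Y k)" d] I Y by (simp add: rad_tnorm_adj)
  finally show ?thesis by simp
qed

text \<open>A minimizer \<open>X\<close> of the regularized norm satisfies the Euler equation
  \<open>X (X*X + e\<^sup>2)\<^bsup>-1/2\<^esup> = (YY* + e\<^sup>2)\<^bsup>-1/2\<^esup> Y\<close> with \<open>Y = C - X\<close>; the common value \<open>D\<close> is a dual certificate.\<close>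

theorem decomposition_le_rad_tnorm:
  fixes C :: "'i \<Rightarrow> cmat" and e :: real
  assumes I: "finite I" and C: "\<And>k. k \<in> I \<Longrightarrow> C k \<in> mats d" and e: "0 < e"
  shows "\<exists>X Y. (\<forall>k\<in>I. X k \<in> mats d \<and> Y k \<in> mats d \<and> C k = X k + Y k) \<and>
    colnorm I X + colnorm I (\<lambda>k. adj (Y k)) \<le> sqrt 2 * rad_tnorm I C + 2 * e * d"
proof -
  let ?h = "\<lambda>X. reg_colnorm d e I X + reg_colnorm d e I (\<lambda>k. adj (C k - X k))"
  have cong: "?h X = ?h Z" if "\<And>k. k \<in> I \<Longrightarrow> X k = Z k" for X Z
    using that by (simp add: reg_colnorm_def cong: sum.cong)
  \<comment> \<open>r is the cost of X = 0. A competitor with some |Z k| > r costs at least r, so a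
    minimizer on the compact set \<open>families d I r\<close> is global.\<close>
  define r where "r = ?h (\<lambda>_. 0)"
  have reg_nonneg: "0 \<le> reg_colnorm d e I X" for X
    unfolding reg_colnorm_def reg_sqrt_trace_def
    by (intro rtr_nonneg pos_csqrt_mat pos_add pos_scaleR pos_column_square) auto
  then have r: "0 \<le> r" unfolding r_def by (intro add_nonneg_nonneg)
  have "continuous_on (families d I r) ?h"
    using C by (intro continuous_on_add continuous_on_reg_colnorm[OF e] continuous_on_coordinate
        bounded_linear.continuous_on[OF bounded_linear_adj] continuous_on_diff continuous_on_const)
      (auto simp: families_iff split: if_splits)
  moreover have zero: "(\<lambda>_. 0) \<in> families d I r" using r by (simp add: families_iff)
  ultimately obtain X where X: "X \<in> families d I r" and min: "\<And>Z. Z \<in> families d I r \<Longrightarrow> ?h X \<le> ?h Z"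
    using continuous_attains_inf[OF compact_families[of d I r]] by blast
  have min': "?h X \<le> ?h Z" if Z: "\<And>k. k \<in> I \<Longrightarrow> Z k \<in> mats d" for Z
  proof (cases "\<forall>k\<in>I. norm (Z k) \<le> r")
    case True
    have "?h X \<le> ?h (\<lambda>k. if k \<in> I then Z k else 0)"
      using True Z by (intro min) (simp add: families_iff)
    also have "\<dots> = ?h Z" by (rule cong) simp
    finally show ?thesis .
  next
    case False
    then obtain k where k: "k \<in> I" "r < norm (Z k)" by auto
    have "norm (Z k) \<le> L2_set (\<lambda>k. norm (Z k)) I" using I k(1) by (intro member_le_L2_set) auto
    also have "\<dots> \<le> colnorm I Z" by (rule L2_set_le_colnorm)
    also have "\<dots> \<le> reg_colnorm d e I Z" using Z e by (rule colnorm_le_reg_colnorm)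
    also have "\<dots> \<le> ?h Z" using reg_nonneg by simp
    finally have "r \<le> ?h Z" using k(2) by simp
    moreover have "?h X \<le> r" using min[OF zero] by (simp only: r_def)
    ultimately show ?thesis by simp
  qed
  define Y where "Y = (\<lambda>k. C k - X k)"
  have XI: "X k \<in> mats d" and YI: "Y k \<in> mats d" if "k \<in> I" for k
    using X C that by (auto simp: families_iff Y_def split: if_splits)
  have aYI: "adj (Y k) \<in> mats d" if "k \<in> I" for k using YI that by simp
  define c where "c = colgrad d e I X"
  define b where "b = colgrad d e I (\<lambda>k. adj (Y k))"
  note c = colgrad_mats[of I X, OF XI e, folded c_def]
  note b = colgrad_mats[of I "\<lambda>k. adj (Y k)", OF aYI e, folded b_def]
    adj_colgrad[of I "\<lambda>k. adj (Y k)", OF aYI e, folded b_def]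
  have innerY: "inner (adj (Y k) * b) (adj B) = inner (b * Y k) B" for k B
    using inner_adj[of "b * Y k" B] by (simp add: adj_mult b(2))
  \<comment> \<open>The gradient of the cost at X. Moving along G gives the linear coefficient
    |G|^2, so minimality forces G = 0; Y moves by -t G.\<close>
  define G where "G = (\<lambda>k. X k * c - b * Y k)"
  have GI: "G k \<in> mats d" if "k \<in> I" for k using XI YI b c that by (simp add: G_def)
  have "0 \<le> t * (\<Sum>k\<in>I. inner (G k) (G k)) +
      t\<^sup>2 * (rtr (c * (\<Sum>k\<in>I. adj (G k) * G k)) / 2 +
             rtr (b * (\<Sum>k\<in>I. adj (adj (- G k)) * adj (- G k))) / 2)" for t
  proof -
    have "?h X \<le> ?h (\<lambda>k. X k + t *\<^sub>R G k)" using XI GI by (intro min') simp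
    also have "(\<lambda>k. adj (C k - (X k + t *\<^sub>R G k))) = (\<lambda>k. adj (Y k) + t *\<^sub>R adj (- G k))"
      by (rule ext) (simp add: Y_def adj_diff adj_add adj_scaleR adj_uminus)
    finally have "reg_colnorm d e I X + reg_colnorm d e I (\<lambda>k. adj (Y k)) \<le>
        reg_colnorm d e I (\<lambda>k. X k + t *\<^sub>R G k) + reg_colnorm d e I (\<lambda>k. adj (Y k) + t *\<^sub>R adj (- G k))"
      by (simp only: Y_def)
    moreover have "reg_colnorm d e I (\<lambda>k. X k + t *\<^sub>R G k) \<le>
       reg_colnorm d e I X + t * (\<Sum>k\<in>I. inner (X k * c) (G k)) + t\<^sup>2 * (rtr (c * (\<Sum>k\<in>I. adj (G k) * G k)) / 2)"
      unfolding c_def by (rule reg_colnorm_perturb[OF XI e GI])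
    moreover have "reg_colnorm d e I (\<lambda>k. adj (Y k) + t *\<^sub>R adj (- G k)) \<le>
       reg_colnorm d e I (\<lambda>k. adj (Y k)) + t * (\<Sum>k\<in>I. inner (adj (Y k) * b) (adj (- G k))) +
       t\<^sup>2 * (rtr (b * (\<Sum>k\<in>I. adj (adj (- G k)) * adj (- G k))) / 2)"
      unfolding b_def using GI aYI e by (intro reg_colnorm_perturb) simp_all
    moreover have "(\<Sum>k\<in>I. inner (G k) (G k)) =
        (\<Sum>k\<in>I. inner (X k * c) (G k)) + (\<Sum>k\<in>I. inner (adj (Y k) * b) (adj (- G k)))"
    proof -
      have "inner (u - v) z = inner u z + inner v (- z)" for u v z :: cmat by (simp add: inner_diff_left)
      then show ?thesis unfolding innerY sum.distrib[symmetric] G_def by (intro sum.cong refl)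
    qed
    ultimately show ?thesis by (simp only: distrib_left)
  qed
  from linear_coefficient_zero[OF this] have "(\<Sum>k\<in>I. inner (G k) (G k)) = 0" .
  then have G0: "X k * c = b * Y k" if "k \<in> I" for k
    using I that by (simp add: sum_nonneg_eq_0_iff G_def)
  define D where "D = (\<lambda>k. X k * c)"
  \<comment> \<open>By the Euler equation D k = b * Y k, so after adjoints the column contraction
    for \<open>adj (Y k)\<close> applies.\<close>
  have row: "(\<Sum>k\<in>I. (norm (W * D k))\<^sup>2) \<le> (norm W)\<^sup>2" for W
  proof -
    have "norm (W * D k) = norm (adj (Y k) * b * adj W)" if "k \<in> I" for k
      using norm_adj[of "W * D k"] G0[OF that] by (simp add: D_def adj_mult b(2) mult.assoc)
    moreover have "(\<Sum>k\<in>I. (norm (adj (Y k) * b * adj W))\<^sup>2) \<le> (norm (adj W))\<^sup>2"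
      unfolding b_def using aYI e by (rule colgrad_contraction)
    ultimately show ?thesis by simp
  qed
  have col: "(\<Sum>k\<in>I. (norm (D k * W))\<^sup>2) \<le> (norm W)\<^sup>2" for W
    unfolding D_def c_def using XI e by (rule colgrad_contraction)
  \<comment> \<open>Each regularized norm exceeds its pairing with D by at most e d.\<close>
  have "colnorm I X + colnorm I (\<lambda>k. adj (Y k)) - 2 * e * d \<le>
        (\<Sum>k\<in>I. inner (D k) (X k)) + (\<Sum>k\<in>I. inner (D k) (Y k))"
  proof -
    have "colnorm I X \<le> reg_colnorm d e I X" using XI e by (rule colnorm_le_reg_colnorm)
    moreover have "colnorm I (\<lambda>k. adj (Y k)) \<le> reg_colnorm d e I (\<lambda>k. adj (Y k))"
      using aYI e by (rule colnorm_le_reg_colnorm)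
    moreover have "reg_colnorm d e I X - e * d \<le> (\<Sum>k\<in>I. inner (X k * c) (X k))"
      unfolding c_def using XI e by (rule reg_colnorm_le_sum_inner)
    moreover have "reg_colnorm d e I (\<lambda>k. adj (Y k)) - e * d \<le> (\<Sum>k\<in>I. inner (adj (Y k) * b) (adj (Y k)))"
      unfolding b_def using aYI e by (rule reg_colnorm_le_sum_inner)
    ultimately show ?thesis using G0 by (simp add: D_def innerY)
  qed
  also have "\<dots> = (\<Sum>k\<in>I. inner (D k) (C k))"
    unfolding sum.distrib[symmetric] by (simp add: Y_def inner_diff_right)
  also have "\<dots> \<le> sqrt 2 * rad_tnorm I C"
    using I col row C by (rule dual_khintchine)
  finally have "colnorm I X + colnorm I (\<lambda>k. adj (Y k)) \<le> sqrt 2 * rad_tnorm I C + 2 * e * d" by simp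
  moreover have "C k = X k + Y k" for k by (simp add: Y_def)
  ultimately show ?thesis using XI YI by (intro exI[of _ X] exI[of _ Y]) simp
qed

subsection \<open>Rademacher functions and transfer to the matrix library\<close>

lemma avg_insert:
  assumes "finite J" "a \<notin> J"
  shows "avg (insert a J) F = (1/2) *\<^sub>R (avg J F + avg J (\<lambda>x. F (insert a x)))"
proof -
  have "(\<Sum>x\<in>Pow (insert a J). F x) = (\<Sum>x\<in>Pow J. F x) + (\<Sum>x\<in>insert a ` Pow J. F x)"
    unfolding Pow_insert using assms by (intro sum.union_disjoint) auto
  also have "(\<Sum>x\<in>insert a ` Pow J. F x) = (\<Sum>x\<in>Pow J. F (insert a x))"
  proof -
    have "inj_on (insert a) (Pow J)"
      by (rule inj_on_inverseI[where g = "\<lambda>x. x - {a}"]) (use assms(2) in blast)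
    then show ?thesis by (simp add: sum.reindex)
  qed
  finally show ?thesis using assms by (simp add: avg_def scaleR_right_distrib)
qed

lemma avg_image:
  assumes "inj_on h J"
  shows "avg (h ` J) F = avg J (\<lambda>x. F (h ` x))"
proof -
  have "Pow (h ` J) = image h ` Pow J" by (simp add: image_Pow_surj)
  moreover have "inj_on (image h) (Pow J)" by (rule inj_on_image_Pow[OF assms])
  ultimately show ?thesis by (simp add: avg_def sum.reindex card_image[OF assms])
qed

text \<open>The smallest index is split off because the first Rademacher sign is constant inside
  each half of the unit interval.\<close>

lemma avg_atLeastAtMost_Suc:
  "avg {1..Suc n} F = (1/2) *\<^sub>R (avg {1..n} (\<lambda>x. F (Suc ` x)) + avg {1..n} (\<lambda>x. F (insert 1 (Suc ` x))))"
proof -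
  have "avg {1..Suc n} F = avg (insert 1 (Suc ` {1..n})) F"
    by (rule arg_cong[of _ _ "\<lambda>J. avg J F"]) (auto simp: image_Suc_atLeastAtMost)
  also have "\<dots> = (1/2) *\<^sub>R (avg (Suc ` {1..n}) F + avg (Suc ` {1..n}) (\<lambda>x. F (insert 1 x)))"
    by (rule avg_insert) auto
  finally show ?thesis by (simp only: avg_image[OF inj_on_subset[OF inj_Suc subset_UNIV]])
qed

text \<open>Zeros of the sine count as positive, which matters only at finitely many t in the unit
  interval.\<close>

definition negatives :: "nat \<Rightarrow> real \<Rightarrow> nat set" where
  "negatives n t = {k\<in>{1..n}. sin (2 ^ k * pi * t) < 0}"

text \<open>The added phase is 2^k pi: whole periods for k >= 1, half a period for k = 0.\<close>

lemma sin_shift: "sin (2 ^ Suc k * pi * ((s + 1) / 2)) = (if k = 0 then - sin (pi * s) else sin (2 ^ k * pi * s))"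
proof (cases k)
  case (Suc j)
  have "2 ^ Suc k * pi * ((s + 1) / 2) = 2 ^ k * pi * s + 2 * pi * of_int (2 ^ j)"
    by (simp add: Suc field_simps)
  then show ?thesis using sin.plus_of_int[of "2 ^ k * pi * s" "2 ^ j"] Suc by (simp add: mult_ac)
next
  case 0
  have "2 ^ Suc 0 * pi * ((s + 1) / 2) = pi * s + pi" by (simp add: field_simps)
  then show ?thesis unfolding 0 by (simp only: sin_periodic_pi if_True simp_thms)
qed

lemma negatives_lower:
  assumes "0 \<le> s" "s \<le> 1"
  shows "negatives (Suc n) (s / 2) = Suc ` negatives n s"
proof -
  have "0 \<le> sin (pi * s)" using assms by (intro sin_ge_zero) (auto simp: mult_left_le)
  then have "k \<in> negatives (Suc n) (s / 2) \<longleftrightarrow> k \<in> Suc ` negatives n s" for k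
  proof (cases k)
    case (Suc j)
    then show ?thesis using \<open>0 \<le> sin (pi * s)\<close> by (cases "j = 0") (auto simp: negatives_def mult.commute)
  qed (auto simp: negatives_def)
  then show ?thesis by blast
qed

text \<open>The endpoints are excluded because sin (pi s) = 0 there, and index 1 would not count as
  negative.\<close>

lemma negatives_upper:
  assumes "0 < s" "s < 1"
  shows "negatives (Suc n) ((s + 1) / 2) = insert 1 (Suc ` negatives n s)"
proof -
  have "0 < sin (pi * s)" using assms by (intro sin_gt_zero) auto
  then have "k \<in> negatives (Suc n) ((s + 1) / 2) \<longleftrightarrow> k \<in> insert 1 (Suc ` negatives n s)" for k
  proof (cases k)
    case (Suc j)
    then show ?thesis using \<open>0 < sin (pi * s)\<close> sin_shift[of j s]
      by (cases "j = 0") (auto simp: negatives_def simp del: power_Suc)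
  qed (auto simp: negatives_def)
  then show ?thesis by blast
qed

text \<open>Induction over the two halves of the interval: on each, the first sign is fixed and the
  other signs form an affine copy of the case n.\<close>

lemma has_integral_negatives:
  fixes F :: "nat set \<Rightarrow> real"
  shows "((\<lambda>t. F (negatives n t)) has_integral avg {1..n} F) {0..1}"
proof (induction n arbitrary: F)
  case 0
  show ?case using has_integral_const_real[of "F {}" 0 1] by (simp add: negatives_def avg_def)
next
  case (Suc n)
  let ?F = "\<lambda>x. F (Suc ` x)" and ?G = "\<lambda>x. F (insert 1 (Suc ` x))"
  have "((\<lambda>t. ?F (negatives n (2 * t))) has_integral (1/2) * avg {1..n} ?F) {0..1/2}"
    using has_integral_affinity[OF Suc.IH[of ?F, unfolded cbox_interval[symmetric]], of 2 0]
    by (simp add: cbox_interval image_affinity_atLeastAtMost)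
  then have lower: "((\<lambda>t. F (negatives (Suc n) t)) has_integral (1/2) * avg {1..n} ?F) {0..1/2}"
    by (rule has_integral_eq[rotated]) (use negatives_lower[of "2 * _" n] in auto)
  have "((\<lambda>t. ?G (negatives n (2 * t - 1))) has_integral (1/2) * avg {1..n} ?G) {1/2..1}"
    using has_integral_affinity[OF Suc.IH[of ?G, unfolded cbox_interval[symmetric]], of 2 "-1"] image_affinity_atLeastAtMost[of "1/2 :: real" "1/2" 0 1]
    by (simp add: cbox_interval)
  then have upper: "((\<lambda>t. F (negatives (Suc n) t)) has_integral (1/2) * avg {1..n} ?G) {1/2..1}"
  proof (rule has_integral_spike_finite[rotated 2])
    show "finite {1/2, 1 :: real}" by simp
    fix t :: real assume "t \<in> {1/2..1} - {1/2, 1}"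
    then show "F (negatives (Suc n) t) = ?G (negatives n (2 * t - 1))"
      using negatives_upper[of "2 * t - 1" n] by simp
  qed
  have "((\<lambda>t. F (negatives (Suc n) t)) has_integral (1/2) * avg {1..n} ?F + (1/2) * avg {1..n} ?G) {0..1}"
    by (rule has_integral_combine[OF _ _ lower upper]) auto
  then show ?case unfolding avg_atLeastAtMost_Suc by (simp add: add_divide_distrib)
qed

text \<open>All zeros in the unit interval are dyadic points j / 2^k with k <= n.\<close>

lemma finite_rademacher_zeros: "finite {t\<in>{0..1}. \<exists>k\<in>{1..n}. rademacher k t = 0}"
proof (rule finite_subset)
  show "{t\<in>{0..1}. \<exists>k\<in>{1..n}. rademacher k t = 0} \<subseteq> (\<lambda>(k, j). real j / 2 ^ k) ` ({1..n} \<times> {..2 ^ n})"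
  proof
    fix t assume "t \<in> {t\<in>{0..1}. \<exists>k\<in>{1..n}. rademacher k t = 0}"
    then obtain k where k: "k \<in> {1..n}" "sin (2 ^ k * pi * t) = 0" and t: "0 \<le> t" "t \<le> 1"
      by (auto simp: rademacher_def sgn_zero_iff)
    then obtain i :: int where "2 ^ k * pi * t = of_int i * pi" by (auto simp: sin_zero_iff_int2)
    then have i: "2 ^ k * t = of_int i" by simp
    have "0 \<le> real_of_int i" using t unfolding i[symmetric] by simp
    then obtain j where j: "i = int j" by (metis of_int_0_le_iff nonneg_int_cases)
    have "2 ^ k * t \<le> 2 ^ k" using t by (simp add: mult_left_le)
    also have "(2::real) ^ k \<le> 2 ^ n" using k(1) by (intro power_increasing) auto
    finally have "real j \<le> real (2 ^ n)" using i j by simp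
    then have "j \<le> 2 ^ n" by (simp only: of_nat_le_iff)
    moreover have "t = real j / 2 ^ k" using i j by (simp add: field_simps)
    ultimately show "t \<in> (\<lambda>(k, j). real j / 2 ^ k) ` ({1..n} \<times> {..2 ^ n})" using k(1) by force
  qed
qed simp

lemma rademacher_eq_eps:
  assumes "k \<in> {1..n}" "rademacher k t \<noteq> 0"
  shows "rademacher k t = eps (negatives n t) k"
  using assms by (auto simp: rademacher_def eps_def negatives_def sgn_if split: if_splits)

section \<open>Transfer between \<open>complex mat\<close> and \<open>cmat\<close>\<close>

definition to_cm :: "complex mat \<Rightarrow> cmat" where
  "to_cm A = Cmat (\<lambda>i j. if i < dim_row A \<and> j < dim_col A then A $$ (i, j) else 0)"

definition of_cm :: "nat \<Rightarrow> cmat \<Rightarrow> complex mat" where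
  "of_cm d B = Matrix.mat d d (\<lambda>(i, j). entry B i j)"

lemma entry_to_cm [simp]: "entry (to_cm A) i j = (if i < dim_row A \<and> j < dim_col A then A $$ (i, j) else 0)"
  unfolding to_cm_def by (subst entry_Cmat(1)[of "max (dim_row A) (dim_col A)"]) auto

lemma to_cm_mats [simp]: "A \<in> carrier_mat d d \<Longrightarrow> to_cm A \<in> mats d"
  by (auto simp: mats_def)

lemma of_cm_carrier [simp]: "of_cm d B \<in> carrier_mat d d"
  by (simp add: of_cm_def)

lemma of_cm_to_cm [simp]: "A \<in> carrier_mat d d \<Longrightarrow> of_cm d (to_cm A) = A"
  by (rule eq_matI) (auto simp: of_cm_def)

lemma to_cm_of_cm [simp]: "B \<in> mats d \<Longrightarrow> to_cm (of_cm d B) = B"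
  by (rule cmat_eqI) (auto simp: of_cm_def mats_entry)

lemma to_cm_add:
  "A \<in> carrier_mat d d \<Longrightarrow> B \<in> carrier_mat d d \<Longrightarrow> to_cm (A + B) = to_cm A + to_cm B"
  by (rule cmat_eqI) auto

lemma to_cm_mult:
  assumes "A \<in> carrier_mat d d" "B \<in> carrier_mat d d"
  shows "to_cm (A * B) = to_cm A * to_cm B"
proof (rule cmat_eqI)
  fix i j
  show "entry (to_cm (A * B)) i j = entry (to_cm A * to_cm B) i j"
    using assms by (auto simp: entry_mult[of _ d] scalar_prod_def atLeast0LessThan intro!: sum.cong)
qed

lemma to_cm_smult: "to_cm (complex_of_real r \<cdot>\<^sub>m A) = r *\<^sub>R to_cm A"
  by (rule cmat_eqI) auto

lemma adjoint_carrier [simp]: "A \<in> carrier_mat d d \<Longrightarrow> mat_adjoint A \<in> carrier_mat d d"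
  by (intro carrier_matI) (simp_all add: mat_adjoint_def)

lemma to_cm_adjoint:
  assumes "A \<in> carrier_mat d d"
  shows "to_cm (mat_adjoint A) = adj (to_cm A)"
proof (rule cmat_eqI)
  fix i j
  show "entry (to_cm (mat_adjoint A)) i j = entry (adj (to_cm A)) i j"
    using assms by (auto simp: mat_adjoint_def mat_of_rows_def)
qed

lemma to_cm_msum:
  assumes "\<And>k. k \<in> K \<Longrightarrow> F k \<in> carrier_mat d d"
  shows "to_cm (msum d F K) = (\<Sum>k\<in>K. to_cm (F k))"
proof (rule cmat_eqI)
  fix i j
  have "(\<Sum>k\<in>K. entry (to_cm (F k)) i j) = (\<Sum>k\<in>K. if i < d \<and> j < d then F k $$ (i, j) else 0)"
    using assms by (intro sum.cong refl) auto
  then show "entry (to_cm (msum d F K)) i j = entry (\<Sum>k\<in>K. to_cm (F k)) i j"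
    by (auto simp: msum_def intro!: sum.neutral)
qed

lemma msum_carrier [simp]: "msum d F K \<in> carrier_mat d d"
  by (simp add: msum_def)

lemma Re_mat_trace: "A \<in> carrier_mat d d \<Longrightarrow> Re (mat_trace A) = rtr (to_cm A)"
  by (subst rtr_eq[of _ d]) (auto simp: mat_trace_def)

lemma inner_to_cm:
  assumes A: "A \<in> carrier_mat d d" and W: "W \<in> mats e" and "d \<le> e"
  shows "inner W (to_cm A * W) =
    (\<Sum>j<e. Re ((A *\<^sub>v Matrix.vec d (\<lambda>i. entry W i j)) \<bullet>c Matrix.vec d (\<lambda>i. entry W i j)))"
proof -
  have Ae: "to_cm A \<in> mats e" using A \<open>d \<le> e\<close> by (intro mats_mono[of _ d e]) simp_all
  have col: "(\<Sum>i<e. Re (cnj (entry W i j) * entry (to_cm A * W) i j)) =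
    Re ((A *\<^sub>v Matrix.vec d (\<lambda>i. entry W i j)) \<bullet>c Matrix.vec d (\<lambda>i. entry W i j))" for j
  proof -
    let ?v = "Matrix.vec d (\<lambda>i. entry W i j)"
    have AW: "entry (to_cm A * W) i j = (if i < d then (A *\<^sub>v ?v) $ i else 0)" for i
      using A by (auto simp: entry_mult[of _ d] scalar_prod_def atLeast0LessThan intro!: sum.cong)
    have "(\<Sum>i<e. Re (cnj (entry W i j) * entry (to_cm A * W) i j)) =
          (\<Sum>i<d. Re (cnj (entry W i j) * (A *\<^sub>v ?v) $ i))"
      unfolding AW using \<open>d \<le> e\<close> by (intro sum.mono_neutral_cong_right) auto
    also have "\<dots> = Re ((A *\<^sub>v ?v) \<bullet>c ?v)"
      using A by (auto simp: scalar_prod_def atLeast0LessThan mult.commute simp del: index_mult_mat_vec intro!: sum.cong)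
    finally show ?thesis .
  qed
  have "inner W (to_cm A * W) = (\<Sum>j<e. \<Sum>i<e. Re (cnj (entry W i j) * entry (to_cm A * W) i j))"
    using W by (subst inner_cmat[of _ e], simp, subst sum.swap, simp)
  then show ?thesis by (simp only: col)
qed

lemma pos_semidef_iff:
  assumes A: "A \<in> carrier_mat d d"
  shows "pos_semidef d A \<longleftrightarrow> pos (to_cm A)"
proof
  assume psd: "pos_semidef d A"
  then have "adj (to_cm A) = to_cm A" using A by (simp add: pos_semidef_def to_cm_adjoint[symmetric])
  moreover have "0 \<le> inner W (to_cm A * W)" for W
  proof -
    obtain e' where "W \<in> mats e'" using ex_mats by blast
    then have "W \<in> mats (max d e')" by (rule mats_mono) simp
    then show ?thesis
      using psd by (subst inner_to_cm[OF A, of _ "max d e'"]) (auto simp: pos_semidef_def intro!: sum_nonneg)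
  qed
  ultimately show "pos (to_cm A)" by (simp add: pos_def)
next
  assume p: "pos (to_cm A)"
  have "to_cm (mat_adjoint A) = to_cm A" using posD(1)[OF p] A by (simp add: to_cm_adjoint)
  then have "mat_adjoint A = A" using A by (metis of_cm_to_cm adjoint_carrier)
  moreover have "0 \<le> Re ((A *\<^sub>v v) \<bullet>c v)" if v: "v \<in> carrier_vec d" for v
  proof -
    \<comment> \<open>v becomes column 0; the size \<open>Suc d\<close> used below keeps column 0 in
      the sum even when d = 0.\<close>
    define W where "W = Cmat (\<lambda>i j. if i < d \<and> j = 0 then v $ i else 0)"
    have W: "entry W i j = (if i < d \<and> j = 0 then v $ i else 0)" for i j
      unfolding W_def by (subst entry_Cmat(1)[of "Suc d"]) auto
    have Wm: "W \<in> mats (Suc d)" by (auto simp: mats_def W)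
    have v0: "Matrix.vec d (\<lambda>i. entry W i 0) = v" using v by (intro eq_vecI) (auto simp: W)
    have vj: "Matrix.vec d (\<lambda>i. entry W i j) = 0\<^sub>v d" if "j \<noteq> 0" for j
      using that by (intro eq_vecI) (auto simp: W)
    have "inner W (to_cm A * W) = (\<Sum>j<Suc d. if j = 0 then Re ((A *\<^sub>v v) \<bullet>c v) else 0)"
      unfolding inner_to_cm[OF A Wm le_SucI[OF order_refl]]
    proof (rule sum.cong[OF refl])
      fix j
      have z: "(A *\<^sub>v 0\<^sub>v d) \<bullet>c 0\<^sub>v d = 0" by (simp add: scalar_prod_def)
      show "Re ((A *\<^sub>v Matrix.vec d (\<lambda>i. entry W i j)) \<bullet>c Matrix.vec d (\<lambda>i. entry W i j)) =
        (if j = 0 then Re ((A *\<^sub>v v) \<bullet>c v) else 0)"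
      proof (cases "j = 0")
        case True
        then show ?thesis by (simp only: v0 if_True simp_thms)
      next
        case False
        then show ?thesis by (simp only: vj[OF False] z if_False simp_thms zero_complex.sel)
      qed
    qed
    then show ?thesis using posD(2)[OF p, of W] by (simp split: if_splits)
  qed
  ultimately show "pos_semidef d A" using A by (simp add: pos_semidef_def)
qed

lemma to_cm_psd_sqrt:
  assumes A: "A \<in> carrier_mat d d" and p: "pos (to_cm A)"
  shows "psd_sqrt d A \<in> carrier_mat d d" "to_cm (psd_sqrt d A) = csqrt_mat (to_cm A)"
proof -
  let ?B = "of_cm d (csqrt_mat (to_cm A))"
  have s: "csqrt_mat (to_cm A) \<in> mats d" using A by (intro csqrt_mat_mats p) simp
  have "psd_sqrt d A = ?B"
    unfolding psd_sqrt_def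
  proof (rule the_equality)
    have "to_cm (?B * ?B) = to_cm A" using s by (simp add: to_cm_mult[of _ d] csqrt_mat_square[OF p])
    then have "?B * ?B = A" using A by (metis of_cm_to_cm of_cm_carrier mult_carrier_mat)
    then show "pos_semidef d ?B \<and> ?B * ?B = A" using s pos_csqrt_mat[OF p] by (simp add: pos_semidef_iff)
  next
    fix B assume B: "pos_semidef d B \<and> B * B = A"
    then have Bc: "B \<in> carrier_mat d d" by (simp add: pos_semidef_def)
    have "csqrt_mat (to_cm A) = to_cm B"
      using B Bc by (intro csqrt_mat_eq) (auto simp: pos_semidef_iff[symmetric] to_cm_mult[of _ d, symmetric])
    then show "B = ?B" using Bc by simp
  qed
  then show "psd_sqrt d A \<in> carrier_mat d d" "to_cm (psd_sqrt d A) = csqrt_mat (to_cm A)" using s by simp_all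
qed

lemma trace_psd_sqrt:
  "A \<in> carrier_mat d d \<Longrightarrow> pos (to_cm A) \<Longrightarrow> Re (mat_trace (psd_sqrt d A)) = rtr (csqrt_mat (to_cm A))"
  by (simp add: Re_mat_trace[of _ d] to_cm_psd_sqrt)

lemma trace_mat_abs:
  "A \<in> carrier_mat d d \<Longrightarrow> Re (mat_trace (mat_abs d A)) = tnorm (to_cm A)"
  unfolding mat_abs_def tnorm_def absm_def
  by (subst trace_psd_sqrt) (simp_all add: to_cm_mult[of _ d] to_cm_adjoint[of _ d] pos_adj_mult mult_carrier_mat[of _ d d _ d])

lemma trace_sqrt_column:
  assumes "\<And>k. k \<in> K \<Longrightarrow> X k \<in> carrier_mat d d"
  shows "Re (mat_trace (psd_sqrt d (msum d (\<lambda>k. mat_adjoint (X k) * X k) K))) = colnorm K (\<lambda>k. to_cm (X k))"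
proof -
  have "to_cm (msum d (\<lambda>k. mat_adjoint (X k) * X k) K) = (\<Sum>k\<in>K. adj (to_cm (X k)) * to_cm (X k))"
    using assms by (subst to_cm_msum) (auto simp: to_cm_mult[of _ d] to_cm_adjoint[of _ d] mult_carrier_mat[of _ d d _ d] intro!: sum.cong)
  then show ?thesis by (simp add: trace_psd_sqrt colnorm_def pos_column_square)
qed

lemma trace_sqrt_row:
  assumes "\<And>k. k \<in> K \<Longrightarrow> Y k \<in> carrier_mat d d"
  shows "Re (mat_trace (psd_sqrt d (msum d (\<lambda>k. Y k * mat_adjoint (Y k)) K))) = colnorm K (\<lambda>k. adj (to_cm (Y k)))"
proof -
  have "to_cm (msum d (\<lambda>k. Y k * mat_adjoint (Y k)) K) = (\<Sum>k\<in>K. adj (adj (to_cm (Y k))) * adj (to_cm (Y k)))"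
    using assms by (subst to_cm_msum) (auto simp: to_cm_mult[of _ d] to_cm_adjoint[of _ d] mult_carrier_mat[of _ d d _ d] intro!: sum.cong)
  moreover have "pos (\<Sum>k\<in>K. adj (adj (to_cm (Y k))) * adj (to_cm (Y k)))" by (rule pos_column_square)
  ultimately show ?thesis by (simp only: trace_psd_sqrt[OF msum_carrier] colnorm_def)
qed

lemma rademacher_avg_eq:
  assumes C: "\<And>k. k \<in> {1..n} \<Longrightarrow> C k \<in> carrier_mat d d"
  shows "rademacher_avg d n C = rad_tnorm {1..n} (\<lambda>k. to_cm (C k))"
proof -
  let ?M = "\<lambda>t. msum d (\<lambda>k. complex_of_real (rademacher k t) \<cdot>\<^sub>m C k) {1..n}"
  let ?F = "\<lambda>x. tnorm (rsum {1..n} (\<lambda>k. to_cm (C k)) x)"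
  have "((\<lambda>t. Re (mat_trace (mat_abs d (?M t)))) has_integral avg {1..n} ?F) {0..1}"
  proof (rule has_integral_spike_finite[OF finite_rademacher_zeros[of n] _ has_integral_negatives[of ?F n]])
    fix t assume t: "t \<in> {0..1} - {t\<in>{0..1}. \<exists>k\<in>{1..n}. rademacher k t = 0}"
    have "to_cm (?M t) = (\<Sum>k\<in>{1..n}. rademacher k t *\<^sub>R to_cm (C k))"
      using C by (subst to_cm_msum) (auto simp: to_cm_smult)
    also have "\<dots> = rsum {1..n} (\<lambda>k. to_cm (C k)) (negatives n t)"
      unfolding rsum_def
    proof (rule sum.cong[OF refl])
      fix k assume k: "k \<in> {1..n}"
      have "rademacher k t \<noteq> 0" using t k by blast
      from rademacher_eq_eps[OF k this]
      show "rademacher k t *\<^sub>R to_cm (C k) = eps (negatives n t) k *\<^sub>R to_cm (C k)" by (rule arg_cong)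
    qed
    finally show "Re (mat_trace (mat_abs d (?M t))) = ?F (negatives n t)"
      by (simp only: trace_mat_abs[OF msum_carrier])
  qed
  then show ?thesis unfolding rademacher_avg_def rad_tnorm_def by (rule integral_unique)
qed

section \<open>The decomposition norm and the sharp constant\<close>

lemma colnorm_cong: "(\<And>k. k \<in> I \<Longrightarrow> X k = Y k) \<Longrightarrow> colnorm I X = colnorm I Y"
  by (simp add: colnorm_def)

definition splits :: "nat \<Rightarrow> nat \<Rightarrow> (nat \<Rightarrow> complex mat) \<Rightarrow> (nat \<Rightarrow> complex mat) \<Rightarrow> (nat \<Rightarrow> complex mat) \<Rightarrow> bool" where
  "splits d n C X Y \<longleftrightarrow> (\<forall>k\<in>{1..n}. X k \<in> carrier_mat d d \<and> Y k \<in> carrier_mat d d \<and> C k = X k + Y k)"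

definition split_cost :: "nat \<Rightarrow> (nat \<Rightarrow> complex mat) \<Rightarrow> (nat \<Rightarrow> complex mat) \<Rightarrow> real" where
  "split_cost n X Y = colnorm {1..n} (\<lambda>k. to_cm (X k)) + colnorm {1..n} (\<lambda>k. adj (to_cm (Y k)))"

lemma S1_l2_norm_eq: "S1_l2_norm d n C = Inf {split_cost n X Y | X Y. splits d n C X Y}"
  unfolding S1_l2_norm_def splits_def[symmetric]
proof (rule arg_cong[of _ _ Inf], rule Collect_cong, rule ex_cong1, rule ex_cong1)
  fix s X Y
  let ?a = "Re (mat_trace (psd_sqrt d (msum d (\<lambda>k. mat_adjoint (X k) * X k) {1..n})))"
  let ?b = "Re (mat_trace (psd_sqrt d (msum d (\<lambda>k. Y k * mat_adjoint (Y k)) {1..n})))"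
  have "?a + ?b = split_cost n X Y" if "splits d n C X Y"
    unfolding split_cost_def using that
    by (intro arg_cong2[of _ _ _ _ "(+)"] trace_sqrt_column trace_sqrt_row) (auto simp: splits_def)
  then show "(s = ?a + ?b \<and> splits d n C X Y) = (s = split_cost n X Y \<and> splits d n C X Y)"
    by (cases "splits d n C X Y") (simp_all only: simp_thms)
qed

lemma le_S1_l2_norm:
  assumes C: "\<And>k. k \<in> {1..n} \<Longrightarrow> C k \<in> carrier_mat d d"
    and le: "\<And>X Y. (\<And>k. k \<in> {1..n} \<Longrightarrow> X k \<in> mats d) \<Longrightarrow> (\<And>k. k \<in> {1..n} \<Longrightarrow> Y k \<in> mats d) \<Longrightarrow>
      (\<And>k. k \<in> {1..n} \<Longrightarrow> to_cm (C k) = X k + Y k) \<Longrightarrow>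
      r \<le> colnorm {1..n} X + colnorm {1..n} (\<lambda>k. adj (Y k))"
  shows "r \<le> S1_l2_norm d n C"
  unfolding S1_l2_norm_eq
proof (rule cInf_greatest)
  have "splits d n C C (\<lambda>_. 0\<^sub>m d d)"
    unfolding splits_def using C by (intro ballI conjI) simp_all
  then show "{split_cost n X Y | X Y. splits d n C X Y} \<noteq> {}" by blast
next
  fix s assume "s \<in> {split_cost n X Y | X Y. splits d n C X Y}"
  then obtain X Y where s: "s = split_cost n X Y" and XY: "splits d n C X Y" by blast
  show "r \<le> s" unfolding s split_cost_def
  proof (rule le)
    fix k assume "k \<in> {1..n}"
    then have "X k \<in> carrier_mat d d" "Y k \<in> carrier_mat d d" "C k = X k + Y k"
      using XY unfolding splits_def by blast+
    then show "to_cm (X k) \<in> mats d" "to_cm (Y k) \<in> mats d" "to_cm (C k) = to_cm (X k) + to_cm (Y k)"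
      by (simp_all add: to_cm_add[of _ d])
  qed
qed

lemma S1_l2_norm_le:
  assumes C: "\<And>k. k \<in> {1..n} \<Longrightarrow> C k \<in> carrier_mat d d"
    and X: "\<And>k. k \<in> {1..n} \<Longrightarrow> X k \<in> mats d" and Y: "\<And>k. k \<in> {1..n} \<Longrightarrow> Y k \<in> mats d"
    and XY: "\<And>k. k \<in> {1..n} \<Longrightarrow> to_cm (C k) = X k + Y k"
  shows "S1_l2_norm d n C \<le> colnorm {1..n} X + colnorm {1..n} (\<lambda>k. adj (Y k))"
  unfolding S1_l2_norm_eq
proof (rule cInf_lower)
  let ?X = "\<lambda>k. of_cm d (X k)" and ?Y = "\<lambda>k. of_cm d (Y k)"
  have "C k = ?X k + ?Y k" if k: "k \<in> {1..n}" for k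
  proof -
    have eq: "to_cm (?X k + ?Y k) = to_cm (C k)" using X[OF k] Y[OF k] XY[OF k] by (simp add: to_cm_add[of _ d])
    have "C k = of_cm d (to_cm (C k))" by (rule of_cm_to_cm[OF C[OF k], symmetric])
    also have "\<dots> = of_cm d (to_cm (?X k + ?Y k))" by (simp only: eq)
    also have "\<dots> = ?X k + ?Y k" by (rule of_cm_to_cm) simp
    finally show ?thesis .
  qed
  then have "splits d n C ?X ?Y" unfolding splits_def by (intro ballI conjI of_cm_carrier)
  then have "split_cost n ?X ?Y \<in> {split_cost n X Y | X Y. splits d n C X Y}" by blast
  moreover have "split_cost n ?X ?Y = colnorm {1..n} X + colnorm {1..n} (\<lambda>k. adj (Y k))"
    unfolding split_cost_def
    by (intro arg_cong2[of _ _ _ _ "(+)"] colnorm_cong arg_cong[of _ _ adj] to_cm_of_cm X Y)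
  ultimately show "colnorm {1..n} X + colnorm {1..n} (\<lambda>k. adj (Y k)) \<in> {split_cost n X Y | X Y. splits d n C X Y}"
    by (simp only:)
next
  have "0 \<le> split_cost n X Y" for X Y unfolding split_cost_def by (intro add_nonneg_nonneg colnorm_nonneg)
  then show "bdd_below {split_cost n X Y | X Y. splits d n C X Y}" by (intro bdd_belowI[of _ 0]) blast
qed

lemma rademacher_avg_le_S1_l2_norm:
  assumes C: "\<And>k. k \<in> {1..n} \<Longrightarrow> C k \<in> carrier_mat d d"
  shows "rademacher_avg d n C \<le> S1_l2_norm d n C"
proof -
  have "rad_tnorm {1..n} (\<lambda>k. to_cm (C k)) \<le> S1_l2_norm d n C"
  proof (rule le_S1_l2_norm)
    show "C k \<in> carrier_mat d d" if "k \<in> {1..n}" for k using that by (rule C)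
  next
    fix X Y
    assume "\<And>k. k \<in> {1..n} \<Longrightarrow> X k \<in> mats d" "\<And>k. k \<in> {1..n} \<Longrightarrow> Y k \<in> mats d"
      "\<And>k. k \<in> {1..n} \<Longrightarrow> to_cm (C k) = X k + Y k"
    with finite_atLeastAtMost
    show "rad_tnorm {1..n} (\<lambda>k. to_cm (C k)) \<le> colnorm {1..n} X + colnorm {1..n} (\<lambda>k. adj (Y k))"
      by (rule rad_tnorm_le_decomposition)
  qed
  moreover have "rademacher_avg d n C = rad_tnorm {1..n} (\<lambda>k. to_cm (C k))"
    using C by (rule rademacher_avg_eq)
  ultimately show ?thesis by simp
qed

lemma S1_l2_norm_le_rademacher_avg:
  assumes C: "\<And>k. k \<in> {1..n} \<Longrightarrow> C k \<in> carrier_mat d d"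
  shows "S1_l2_norm d n C \<le> sqrt 2 * rademacher_avg d n C"
proof (rule field_le_epsilon)
  fix \<delta> :: real assume \<delta>: "0 < \<delta>"
  define e where "e = \<delta> / (2 * (d + 1))"
  have e: "0 < e" "2 * e * d \<le> \<delta>" using \<delta> by (auto simp: e_def field_simps)
  have Cm: "to_cm (C k) \<in> mats d" if "k \<in> {1..n}" for k using C[OF that] by simp
  obtain X Y where "\<forall>k\<in>{1..n}. X k \<in> mats d \<and> Y k \<in> mats d \<and> to_cm (C k) = X k + Y k"
    and le: "colnorm {1..n} X + colnorm {1..n} (\<lambda>k. adj (Y k)) \<le> sqrt 2 * rad_tnorm {1..n} (\<lambda>k. to_cm (C k)) + 2 * e * d"
    using decomposition_le_rad_tnorm[of "{1..n}" "\<lambda>k. to_cm (C k)" d e] Cm e(1) by blast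
  with C have "S1_l2_norm d n C \<le> colnorm {1..n} X + colnorm {1..n} (\<lambda>k. adj (Y k))"
    by (intro S1_l2_norm_le) simp_all
  moreover have "rademacher_avg d n C = rad_tnorm {1..n} (\<lambda>k. to_cm (C k))"
    using C by (rule rademacher_avg_eq)
  ultimately show "S1_l2_norm d n C \<le> sqrt 2 * rademacher_avg d n C + \<delta>"
    using le e(2) by simp
qed

lemma tnorm_idm_1: "tnorm (idm 1) = 1"
proof -
  have "absm (idm 1) = idm 1" unfolding absm_def by (rule csqrt_mat_eq) simp_all
  then show ?thesis by (simp add: tnorm_def)
qed

text \<open>For \<open>d = 1\<close>, \<open>n = 2\<close> and \<open>C = (1, 1)\<close> the average is 1, whereas the norm dominates the
  \<open>\<ell>\<^sub>2\<close>-norm of \<open>C\<close>.\<close>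

lemma upper_khintchine_const_ge_sqrt2:
  assumes A: "upper_khintchine_const A"
  shows "sqrt 2 \<le> A"
proof -
  let ?C = "\<lambda>_::nat. 1\<^sub>m 1 :: complex mat"
  have one: "to_cm (1\<^sub>m 1) = idm 1" by (rule cmat_eqI) auto
  have I: "{1..2} = {1, 2 :: nat}" by auto
  have "rsum {1..2} (\<lambda>_. idm 1) x = (eps x 1 + eps x 2) *\<^sub>R idm 1" for x :: "nat set"
    unfolding I rsum_def by (simp add: scaleR_left_distrib)
  then have t: "tnorm (rsum {1..2} (\<lambda>_. idm 1) x) = \<bar>eps x 1 + eps x 2\<bar>" for x :: "nat set"
    by (simp only: tnorm_scaleR tnorm_idm_1 mult_1_right)
  have "rademacher_avg 1 2 ?C = avg {1, 2} (\<lambda>x. \<bar>eps x 1 + eps x (2::nat)\<bar>)"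
    unfolding rademacher_avg_eq[of 2 ?C 1, OF one_carrier_mat] rad_tnorm_def one I t[unfolded I] ..
  \<comment> \<open>The sum of two signs has absolute value 2 or 0, each for half of the
    patterns.\<close>
  also have "\<dots> = 1" by (simp add: avg_insert) (simp add: avg_def eps_def)
  finally have avg1: "rademacher_avg 1 2 ?C = 1" .
  have "sqrt 2 \<le> S1_l2_norm 1 2 ?C"
  proof (rule le_S1_l2_norm)
    fix X Y :: "nat \<Rightarrow> cmat"
    assume XY: "\<And>k. k \<in> {1..2} \<Longrightarrow> to_cm (1\<^sub>m 1) = X k + Y k"
    have n1: "norm (idm 1) = 1" by (simp add: norm_eq_sqrt_inner inner_cmat_def)
    \<comment> \<open>For an arbitrary split, the triangle inequality in each coordinate and then in
      the l2 norm gives at least the length of (1, 1).\<close>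
    have "1 \<le> norm (X k) + norm (Y k)" if "k \<in> {1..2}" for k
      using norm_triangle_ineq[of "X k" "Y k"] XY[OF that] n1 one by simp
    then have "L2_set (\<lambda>_. 1) {1..2::nat} \<le> L2_set (\<lambda>k. norm (X k) + norm (Y k)) {1..2}"
      by (intro L2_set_mono) auto
    also have "\<dots> \<le> L2_set (\<lambda>k. norm (X k)) {1..2} + L2_set (\<lambda>k. norm (adj (Y k))) {1..2}"
      by (simp add: L2_set_triangle_ineq)
    also have "\<dots> \<le> colnorm {1..2} X + colnorm {1..2} (\<lambda>k. adj (Y k))"
      by (intro add_mono L2_set_le_colnorm)
    finally show "sqrt 2 \<le> colnorm {1..2} X + colnorm {1..2} (\<lambda>k. adj (Y k))"
      by (simp add: L2_set_def)
  qed simp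
  also have "\<dots> \<le> A * rademacher_avg 1 2 ?C"
    using A unfolding upper_khintchine_const_def by (meson one_carrier_mat)
  finally show ?thesis by (simp only: avg1 mult_1_right)
qed

theorem theorem4p1:
  shows "(\<forall>d n C. (\<forall>k\<in>{1..n}. C k \<in> carrier_mat d d) \<longrightarrow>
            rademacher_avg d n C \<le> S1_l2_norm d n C \<and>
            S1_l2_norm d n C \<le> sqrt 2 * rademacher_avg d n C) \<and>
         (upper_khintchine_const (sqrt 2) \<and>
          (\<forall>A. upper_khintchine_const A \<longrightarrow> sqrt 2 \<le> A))"
  using rademacher_avg_le_S1_l2_norm S1_l2_norm_le_rademacher_avg upper_khintchine_const_ge_sqrt2
  unfolding upper_khintchine_const_def by blast

end
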